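(* Let $P$ be a positive pattern on four vertices whose set of mandatory edges forms a path on four vertices (with the vertices of the path in any order with respect to the order of $P$). Then $P$-Detection can be solved in linear time $O(n+m)$ on ordered graphs with $n$ vertices and $m$ edges.
   Context: A pattern $P$ consists of a finite totally ordered vertex set $V(P)$ with a partition of the unordered pairs of distinct vertices into mandatory edges $M(P)$, forbidden edges $F(P)$ and undecided pairs $U(P)$; it is positive if $F(P)=\emptyset$. An ordered graph $(G,\tau)$ (finite simple graph given by adjacency lists, with a total order $\tau$ of its vertices) contains $P$ if there is $X\subseteq V(G)$, $|X|=|V(P)|$, such that under the order-preserving bijection $X\to V(P)$ all mandatory pairs are edges of $G$ (and all forbidden pairs non-edges). $P$-Detection: decide whether $(G,\tau)$ contains $P$. *)

theory Defs
  imports Main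
begin

section \<open>Patterns and ordered graphs\<close>

definition pairs_of :: "'a set \<Rightarrow> 'a set set" where
  "pairs_of A = {{x, y} | x y. x \<in> A \<and> y \<in> A \<and> x \<noteq> y}"

record 'a pattern =
  pverts :: "'a set"
  pord :: "'a rel"
  mandatory :: "'a set set"
  forbidden :: "'a set set"
  undecided :: "'a set set"

definition is_pattern :: "'a pattern \<Rightarrow> bool" where
  "is_pattern P \<longleftrightarrow>
     finite (pverts P) \<and>
     linear_order_on (pverts P) (pord P) \<and>
     mandatory P \<union> forbidden P \<union> undecided P = pairs_of (pverts P) \<and>
     mandatory P \<inter> forbidden P = {} \<and>
     mandatory P \<inter> undecided P = {} \<and>
     forbidden P \<inter> undecided P = {}"

definition positive :: "'a pattern \<Rightarrow> bool" where
  "positive P \<longleftrightarrow> forbidden P = {}"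

text \<open>The order of the path \<open>a\<close>, \<open>b\<close>, \<open>c\<close>, \<open>d\<close> is unrelated to \<^const>\<open>pord\<close>.\<close>

definition mandatory_is_P4 :: "'a pattern \<Rightarrow> bool" where
  "mandatory_is_P4 P \<longleftrightarrow>
     (\<exists>a b c d. distinct [a, b, c, d] \<and> pverts P = {a, b, c, d} \<and>
        mandatory P = {{a, b}, {b, c}, {c, d}})"

record 'v ordered_graph =
  verts :: "'v set"
  edges :: "'v set set"
  vord :: "'v rel"

definition is_ordered_graph :: "'v ordered_graph \<Rightarrow> bool" where
  "is_ordered_graph G \<longleftrightarrow>
     finite (verts G) \<and> edges G \<subseteq> pairs_of (verts G) \<and> linear_order_on (verts G) (vord G)"

definition contains_pattern :: "'v ordered_graph \<Rightarrow> 'a pattern \<Rightarrow> bool" where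
  "contains_pattern G P \<longleftrightarrow>
     (\<exists>X f. X \<subseteq> verts G \<and> card X = card (pverts P) \<and>
        bij_betw f X (pverts P) \<and>
        (\<forall>x\<in>X. \<forall>y\<in>X. (x, y) \<in> vord G \<longleftrightarrow> (f x, f y) \<in> pord P) \<and>
        (\<forall>x\<in>X. \<forall>y\<in>X. {f x, f y} \<in> mandatory P \<longrightarrow> {x, y} \<in> edges G) \<and>
        (\<forall>x\<in>X. \<forall>y\<in>X. {f x, f y} \<in> forbidden P \<longrightarrow> {x, y} \<notin> edges G))"


section \<open>Word RAM programs\<close>

text \<open>
  The cost model is a word RAM with programs in structured form.  A state has word-sized
  registers and random-access arrays of words; a program mentions only finitely many registers and
  arrays, by constant names, so the arrays can be interleaved in a single memory with constant
  overhead.  The only arithmetic is addition and (truncated) subtraction.  Every execution is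
  relative to a word bound \<open>B\<close>: a step that would use an address or produce a value that is not
  below \<open>B\<close> has no transition, so an overflowing program does not terminate successfully, and no
  computation can be packed into large numbers.
\<close>

datatype operand = Const nat | Reg nat

datatype test = Less operand operand | Equal operand operand

datatype com =
    Skip
  | Move nat operand
  | Add nat operand operand
  | Sub nat operand operand
  | Load nat nat operand        (* Load r a i: register r receives entry i of array a *)
  | Store nat operand operand   (* Store a i x: entry i of array a receives x *)
  | Seq com com
  | If test com com
  | While test com

record state =
  regs :: "nat \<Rightarrow> nat"
  arrs :: "nat \<Rightarrow> nat \<Rightarrow> nat"

fun val :: "state \<Rightarrow> operand \<Rightarrow> nat" where
  "val s (Const k) = k"
| "val s (Reg r) = regs s r"

fun holds :: "state \<Rightarrow> test \<Rightarrow> bool" where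
  "holds s (Less x y) \<longleftrightarrow> val s x < val s y"
| "holds s (Equal x y) \<longleftrightarrow> val s x = val s y"

definition set_reg :: "nat \<Rightarrow> nat \<Rightarrow> state \<Rightarrow> state" where
  "set_reg r v s = s\<lparr>regs := (regs s)(r := v)\<rparr>"

definition set_arr :: "nat \<Rightarrow> nat \<Rightarrow> nat \<Rightarrow> state \<Rightarrow> state" where
  "set_arr a i v s = s\<lparr>arrs := (arrs s)(a := (arrs s a)(i := v))\<rparr>"

text \<open>\<open>exec B p s t s'\<close>: started in \<open>s\<close>, program \<open>p\<close> halts in \<open>s'\<close> after \<open>t\<close> elementary steps.\<close>

inductive exec :: "nat \<Rightarrow> com \<Rightarrow> state \<Rightarrow> nat \<Rightarrow> state \<Rightarrow> bool" for B where
  Skip: "exec B Skip s 1 s"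
| Move: "val s x < B \<Longrightarrow> exec B (Move r x) s 1 (set_reg r (val s x) s)"
| Add: "val s x + val s y < B \<Longrightarrow> exec B (Add r x y) s 1 (set_reg r (val s x + val s y) s)"
| Sub: "val s x - val s y < B \<Longrightarrow> exec B (Sub r x y) s 1 (set_reg r (val s x - val s y) s)"
| Load: "val s i < B \<Longrightarrow> arrs s a (val s i) < B \<Longrightarrow>
    exec B (Load r a i) s 1 (set_reg r (arrs s a (val s i)) s)"
| Store: "val s i < B \<Longrightarrow> val s x < B \<Longrightarrow>
    exec B (Store a i x) s 1 (set_arr a (val s i) (val s x) s)"
| Seq: "exec B p s t s' \<Longrightarrow> exec B q s' u s'' \<Longrightarrow> exec B (Seq p q) s (t + u) s''"
| IfTrue: "holds s b \<Longrightarrow> exec B p s t s' \<Longrightarrow> exec B (If b p q) s (1 + t) s'"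
| IfFalse: "\<not> holds s b \<Longrightarrow> exec B q s t s' \<Longrightarrow> exec B (If b p q) s (1 + t) s'"
| WhileFalse: "\<not> holds s b \<Longrightarrow> exec B (While b p) s 1 s"
| WhileTrue: "holds s b \<Longrightarrow> exec B p s t s' \<Longrightarrow> exec B (While b p) s' u s'' \<Longrightarrow>
    exec B (While b p) s (1 + t + u) s''"

lemma exec_deterministic:
  "exec B p s t s' \<Longrightarrow> exec B p s u s'' \<Longrightarrow> u = t \<and> s'' = s'"
proof (induction arbitrary: u s'' rule: exec.induct)
  case (Seq p s t s' q v r)
  from Seq.prems show ?case by (cases) (use Seq.IH in blast)
next
  case (IfTrue s b p t s' q)
  from IfTrue.prems show ?case by (cases) (use IfTrue in blast)+
next
  case (IfFalse s b q t s' p)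
  from IfFalse.prems show ?case by (cases) (use IfFalse in blast)+
next
  case (WhileFalse s b p)
  from WhileFalse.prems show ?case by (cases) (use WhileFalse in blast)+
next
  case (WhileTrue s b p t s' v r)
  from WhileTrue.prems show ?case by (cases) (use WhileTrue in blast)+
qed (erule exec.cases; simp)+


section \<open>Linear-time decision problems on ordered graphs\<close>

text \<open>
  An input describes an ordered graph with vertices \<open>0, \<dots>, n - 1\<close>: \<open>adj ! v\<close> lists the
  neighbours of \<open>v\<close> in arbitrary order, without repetition, and \<open>vs\<close> lists the vertices in
  increasing order with respect to \<^const>\<open>vord\<close> (which need not be the order of the numbers).
\<close>

definition represents :: "nat list list \<Rightarrow> nat list \<Rightarrow> nat ordered_graph \<Rightarrow> bool" where
  "represents adj vs G \<longleftrightarrow>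
     verts G = {..<length adj} \<and>
     (\<forall>v<length adj. distinct (adj ! v) \<and> set (adj ! v) = {w. {v, w} \<in> edges G}) \<and>
     distinct vs \<and> set vs = verts G \<and>
     vord G = {(vs ! i, vs ! j) | i j. i \<le> j \<and> j < length vs}"

text \<open>
  Register 0 holds \<open>n\<close>.  Array 1 is the concatenation of the adjacency lists, with the list of
  \<open>v\<close> occupying the positions from entry \<open>v\<close> of array 0 up to, but excluding, entry \<open>v + 1\<close> of
  array 0.  Array 2 holds the vertex order.  Everything else is 0.
\<close>

definition input_state :: "nat list list \<Rightarrow> nat list \<Rightarrow> state" where
  "input_state adj vs =
     \<lparr>regs = (\<lambda>r. if r = 0 then length adj else 0),
      arrs = (\<lambda>a i.
        if a = 0 \<and> i \<le> length adj then sum_list (map length (take i adj))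
        else if a = 1 \<and> i < length (concat adj) then concat adj ! i
        else if a = 2 \<and> i < length vs then vs ! i
        else 0)\<rparr>"

text \<open>
  One program must answer (in register 0) on all inputs, within \<open>O(n + m)\<close> steps and with words of
  \<open>log (n + m) + O(1)\<close> bits; the summand 1 only matters for the graph without vertices.
\<close>

definition decidable_in_linear_time :: "(nat ordered_graph \<Rightarrow> bool) \<Rightarrow> bool" where
  "decidable_in_linear_time Q \<longleftrightarrow>
     (\<exists>p c. \<forall>G adj vs. is_ordered_graph G \<longrightarrow> represents adj vs G \<longrightarrow>
        (let N = card (verts G) + card (edges G) + 1
         in \<exists>t s. exec (c * N) p (input_state adj vs) t s \<and> t \<le> c * N \<and>
              regs s 0 = (if Q G then 1 else 0)))"

end

theory Submission
  imports Defs
begin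

text \<open>
  Let \<open>a\<close>, \<open>b\<close>, \<open>c\<close>, \<open>d\<close> be the path of the pattern, reversed if necessary so that \<open>a\<close> precedes
  \<open>d\<close>.  Fix the image of the middle edge.  Among \<open>b\<close>, \<open>c\<close> and the two ends of the order, let \<open>l\<close> be
  the last one before \<open>a\<close> and \<open>u\<close> the first one after \<open>d\<close>.  Since \<open>a\<close> precedes \<open>d\<close>, replacing \<open>a\<close> by
  the first neighbour of \<open>b\<close> after \<open>l\<close> and \<open>d\<close> by the last neighbour of \<open>c\<close> before \<open>u\<close> does no harm,
  so one pair of candidates per middle edge suffices.  The candidates are found in constant time
  in adjacency lists sorted by rank, given the place of \<open>c\<close> in the list of \<open>b\<close> and vice versa.
  Visiting the vertices in increasing order and appending each one to the lists of its neighbours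
  sorts all lists.  A second pass over the sorted lists, with the same cursors, meets every pair of
  adjacent vertices with the places of both in each other's lists at hand.
\<close>

section \<open>Running times of programs\<close>

text \<open>\<open>T\<close> only bounds the running time, so branches of different length can be
  joined without tracking exact times.\<close>

definition terminates :: "nat \<Rightarrow> com \<Rightarrow> state \<Rightarrow> nat \<Rightarrow> (state \<Rightarrow> bool) \<Rightarrow> bool" where
  "terminates B p s T Q \<longleftrightarrow> (\<exists>t s'. exec B p s t s' \<and> t \<le> T \<and> Q s')"

lemma terminates_mono:
  assumes "terminates B p s T Q" "T \<le> T'" "\<And>s'. Q s' \<Longrightarrow> Q' s'"
  shows "terminates B p s T' Q'"
  using assms unfolding terminates_def by (meson order_trans)

lemma terminates_Seq:
  assumes "terminates B p s T R" "\<And>s'. R s' \<Longrightarrow> terminates B q s' U Q"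
  shows "terminates B (Seq p q) s (T + U) Q"
proof -
  obtain t s1 where 1: "exec B p s t s1" "t \<le> T" "R s1"
    using assms(1) unfolding terminates_def by blast
  obtain u s2 where 2: "exec B q s1 u s2" "u \<le> U" "Q s2"
    using assms(2)[OF 1(3)] unfolding terminates_def by blast
  show ?thesis
    unfolding terminates_def using exec.Seq[OF 1(1) 2(1)] 1 2 by (meson add_mono)
qed

text \<open>The bound \<open>T k\<close> may vary with the counter, which the loop over vertices
  needs because degrees differ. Each summand 1 is a successful loop test, the leading 1 the final
  failing one.\<close>

lemma terminates_For:
  assumes "I a s" "a \<le> b"
    and step: "\<And>k s. a \<le> k \<Longrightarrow> k < b \<Longrightarrow> I k s \<Longrightarrow>
      holds s c \<and> terminates B p s (T k) (I (Suc k))"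
    and stop: "\<And>s. I b s \<Longrightarrow> \<not> holds s c"
  shows "terminates B (While c p) s (1 + (\<Sum>k=a..<b. 1 + T k)) (I b)"
  using assms(2,1) step
proof (induction a arbitrary: s rule: inc_induct)
  case base
  then show ?case
    unfolding terminates_def using exec.WhileFalse[OF stop]
    by (metis add.right_neutral atLeastLessThan_empty_iff less_irrefl order_refl
        sum.empty)
next
  case (step a)
  obtain t s1 where 1: "exec B p s t s1" "t \<le> T a" "I (Suc a) s1" "holds s c"
    using step.prems(2)[of a s] step.prems(1) step.hyps unfolding terminates_def by blast
  obtain u s2 where 2: "exec B (While c p) s1 u s2" "u \<le> 1 + (\<Sum>k=Suc a..<b. 1 + T k)" "I b s2"
    using step.IH[OF 1(3)] step.prems(2) unfolding terminates_def by (meson Suc_leD)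
  have "1 + t + u \<le> 1 + (\<Sum>k=a..<b. 1 + T k)"
    using 1(2) 2(2) step.hyps by (simp add: sum.atLeast_Suc_lessThan)
  then show ?case
    unfolding terminates_def using exec.WhileTrue[OF 1(4,1) 2(1)] 2(3) by blast
qed

section \<open>Weakest preconditions and step counts of loop-free code\<close>

text \<open>Simplification with these equations reduces straight-line code to its word-bound
  conditions and a claim about the final state. The value \<open>False\<close> for loops keeps
  \<open>terminates_wp\<close> sound for all programs.\<close>

fun wp :: "nat \<Rightarrow> com \<Rightarrow> (state \<Rightarrow> bool) \<Rightarrow> state \<Rightarrow> bool" where
  "wp B Skip Q s \<longleftrightarrow> Q s"
| "wp B (Move r x) Q s \<longleftrightarrow> val s x < B \<and> Q (set_reg r (val s x) s)"
| "wp B (Add r x y) Q s \<longleftrightarrow> val s x + val s y < B \<and> Q (set_reg r (val s x + val s y) s)"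
| "wp B (Sub r x y) Q s \<longleftrightarrow> val s x - val s y < B \<and> Q (set_reg r (val s x - val s y) s)"
| "wp B (Load r a i) Q s \<longleftrightarrow>
    val s i < B \<and> arrs s a (val s i) < B \<and> Q (set_reg r (arrs s a (val s i)) s)"
| "wp B (Store a i x) Q s \<longleftrightarrow>
    val s i < B \<and> val s x < B \<and> Q (set_arr a (val s i) (val s x) s)"
| "wp B (Seq p q) Q s \<longleftrightarrow> wp B p (wp B q Q) s"
| "wp B (If b p q) Q s \<longleftrightarrow> (if holds s b then wp B p Q s else wp B q Q s)"
| "wp B (While b p) Q s \<longleftrightarrow> False"

text \<open>Meaningful for loop-free programs only.\<close>

fun cost :: "com \<Rightarrow> nat" where
  "cost (Seq p q) = cost p + cost q"
| "cost (If b p q) = 1 + max (cost p) (cost q)"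
| "cost p = 1"

lemma terminates_wp: "wp B p Q s \<Longrightarrow> terminates B p s (cost p) Q"
proof (induction p arbitrary: Q s)
  case (Seq p q)
  then have "terminates B p s (cost p) (wp B q Q)" by simp
  then show ?case by (auto intro: terminates_Seq Seq.IH)
next
  case (If b p q)
  show ?case
  proof (cases "holds s b")
    case True
    with If obtain t s' where "exec B p s t s'" "t \<le> cost p" "Q s'"
      unfolding terminates_def by force
    then show ?thesis
      unfolding terminates_def using exec.IfTrue[OF True]
      by (metis add_left_mono cost.simps(2) max.coboundedI1)
  next
    case False
    with If obtain t s' where "exec B q s t s'" "t \<le> cost q" "Q s'"
      unfolding terminates_def by force
    then show ?thesis
      unfolding terminates_def using exec.IfFalse[OF False]
      by (metis add_left_mono cost.simps(2) max.coboundedI2)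
  qed
qed (auto simp: terminates_def intro!: exI[of _ "Suc 0"]
    intro: exec.intros[unfolded One_nat_def])

lemma terminates_wpI: "wp B p Q s \<Longrightarrow> cost p = T \<Longrightarrow> terminates B p s T Q"
  using terminates_wp by blast

lemma wp_mono: "wp B p Q s \<Longrightarrow> (\<And>s'. Q s' \<Longrightarrow> Q' s') \<Longrightarrow> wp B p Q' s"
  by (induction p arbitrary: Q Q' s) (auto split: if_splits)

lemma state_simps [simp]:
  "regs (set_reg r v s) q = (if q = r then v else regs s q)"
  "arrs (set_reg r v s) = arrs s"
  "regs (set_arr a i v s) = regs s"
  "arrs (set_arr a i v s) b = (if b = a then (arrs s a)(i := v) else arrs s b)"
  by (auto simp: set_reg_def set_arr_def)

fun guarded :: "test list \<Rightarrow> com \<Rightarrow> com" where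
  "guarded [] p = p"
| "guarded (b # bs) p = If b (guarded bs p) Skip"

text \<open>Tests do not change the state, so nested conditionals collapse into one case distinction
  on their conjunction.\<close>

lemma wp_guarded:
  "wp B (guarded bs p) Q s \<longleftrightarrow> (if \<forall>b\<in>set bs. holds s b then wp B p Q s else Q s)"
  by (induction bs) auto

section \<open>The algorithm\<close>

fun block :: "com list \<Rightarrow> com" where
  "block [p] = p"
| "block (p # ps) = Seq p (block ps)"

abbreviation counting_loop :: "com \<Rightarrow> com" where
  "counting_loop p \<equiv> Seq (Move 1 (Const 0)) (While (Less (Reg 1) (Reg 0)) p)"

definition rank_loop :: com where
  "rank_loop = counting_loop
     (block [Load 2 2 (Reg 1), Store 3 (Reg 2) (Reg 1), Add 1 (Reg 1) (Const 1)])"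

definition reset_loop :: com where
  "reset_loop = counting_loop
     (block [Load 2 0 (Reg 1), Store 4 (Reg 1) (Reg 2), Add 1 (Reg 1) (Const 1)])"

text \<open>
  A sweep visits vertex \<open>x\<close> (register 2) of rank \<open>i\<close> (register 1) and the entries \<open>p\<close> (register 3)
  of its list in array \<open>src\<close>.  Array 4 holds for each vertex \<open>b\<close> a cursor into the list of \<open>b\<close>, which
  points to the place \<open>q\<close> (register 6) of \<open>x\<close> in the sorted list when entry \<open>b\<close> (register 5) is
  met.  Array 3 holds ranks, array 6 the sorted lists, and array 5 for each vertex the place where
  it would be inserted into its own sorted list.
\<close>

definition sweep :: "nat \<Rightarrow> com \<Rightarrow> com" where
  "sweep src hook = Seq reset_loop (counting_loop
     (Seq (block [Load 2 2 (Reg 1), Load 3 0 (Reg 2), Add 4 (Reg 2) (Const 1), Load 4 0 (Reg 4)])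
     (Seq (While (Less (Reg 3) (Reg 4))
        (Seq (block [Load 5 src (Reg 3), Load 6 4 (Reg 5), Add 8 (Reg 6) (Const 1),
            Store 4 (Reg 5) (Reg 8)])
        (Seq hook
          (Add 3 (Reg 3) (Const 1)))))
      (Add 1 (Reg 1) (Const 1)))))"

text \<open>When \<open>x\<close> is visited, exactly its neighbours of smaller rank have been
  appended to its list, so the cursor of \<open>x\<close> is the place of \<open>x\<close> in its
  own list. This value is stored anew for each entry of the list, always unchanged.\<close>

definition sort_hook :: com where
  "sort_hook = block [Store 6 (Reg 6) (Reg 2), Load 8 4 (Reg 2), Store 5 (Reg 2) (Reg 8)]"

definition lt_test :: "bool \<Rightarrow> operand \<Rightarrow> operand \<Rightarrow> test" where
  "lt_test f x y = (if f then Less x y else Less y x)"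

text \<open>Equal ranks are rejected for either value of the flag, so a passed test also shows that
  the two vertices differ.\<close>

definition lt_flag :: "bool \<Rightarrow> nat \<Rightarrow> nat \<Rightarrow> bool" where
  "lt_flag f x y = (if f then x < y else y < x)"

lemma holds_lt_test [simp]: "holds s (lt_test f x y) = lt_flag f (val s x) (val s y)"
  by (simp add: lt_test_def lt_flag_def)

datatype bound = Unbounded | At_b | At_c

text \<open>In the second sweep \<open>x\<close> is \<open>c\<close>. The candidate for
  \<open>a\<close> stands at the start of the list of \<open>b\<close>, at the place where
  \<open>b\<close> would be inserted, or just after \<open>c\<close>.\<close>

fun load_first :: "bound \<Rightarrow> com" where
  "load_first Unbounded = Load 8 0 (Reg 5)"
| "load_first At_b = Load 8 5 (Reg 5)"
| "load_first At_c = Add 8 (Reg 6) (Const 1)"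

text \<open>This index is exclusive: the end of the list of \<open>c\<close>, the place of
  \<open>b\<close> in it, or the place where \<open>c\<close> would be inserted. The candidate for
  \<open>d\<close> stands one entry before.\<close>

fun load_last :: "bound \<Rightarrow> com" where
  "load_last Unbounded = Move 9 (Reg 4)"
| "load_last At_b = Move 9 (Reg 3)"
| "load_last At_c = Load 9 5 (Reg 2)"

text \<open>
  The flags give the order of the pattern on its path \<open>a\<close>, \<open>b\<close>, \<open>c\<close>, \<open>d\<close> with \<open>a\<close> before \<open>d\<close>: the
  flag \<open>ba\<close> says that \<open>b\<close> precedes \<open>a\<close>, and so on.
\<close>

definition order_ok ::
  "bool \<Rightarrow> bool \<Rightarrow> bool \<Rightarrow> bool \<Rightarrow> bool \<Rightarrow> nat \<Rightarrow> nat \<Rightarrow> nat \<Rightarrow> nat \<Rightarrow> bool" where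
  "order_ok ba ca bc bd cd ra rb rc rd \<longleftrightarrow>
     ra < rd \<and> lt_flag ba rb ra \<and> lt_flag ca rc ra \<and> lt_flag bc rb rc \<and> lt_flag bd rb rd \<and>
     lt_flag cd rc rd"

definition lower :: "bool \<Rightarrow> bool \<Rightarrow> bool \<Rightarrow> bound" where
  "lower ba ca bc =
     (if ba \<and> (ca \<longrightarrow> \<not> bc) then At_b else if ca then At_c else Unbounded)"

definition upper :: "bool \<Rightarrow> bool \<Rightarrow> bool \<Rightarrow> bound" where
  "upper bc bd cd =
     (if \<not> bd \<and> (\<not> cd \<longrightarrow> bc) then At_b else if \<not> cd then At_c else Unbounded)"

text \<open>The outer two comparisons fail if there is no candidate for \<open>a\<close> or for
  \<open>d\<close>. The candidates respect only the bounds chosen for them, hence the full order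
  test at the end.\<close>

definition test_hook :: "bool \<Rightarrow> bool \<Rightarrow> bool \<Rightarrow> bool \<Rightarrow> bool \<Rightarrow> com" where
  "test_hook ba ca bc bd cd =
     block [load_first (lower ba ca bc), Add 9 (Reg 5) (Const 1), Load 9 0 (Reg 9),
       If (Less (Reg 8) (Reg 9))
         (block [Load 8 6 (Reg 8), load_last (upper bc bd cd), Load 10 0 (Reg 2),
            If (Less (Reg 10) (Reg 9))
              (block [Sub 9 (Reg 9) (Const 1), Load 9 6 (Reg 9), Load 8 3 (Reg 8),
                Load 9 3 (Reg 9), Load 10 3 (Reg 5), Load 11 3 (Reg 2),
                guarded
                  [Less (Reg 8) (Reg 9), lt_test ba (Reg 10) (Reg 8), lt_test ca (Reg 11) (Reg 8),
                   lt_test bc (Reg 10) (Reg 11), lt_test bd (Reg 10) (Reg 9),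
                   lt_test cd (Reg 11) (Reg 9)]
                  (Move 7 (Const 1))])
              Skip])
         Skip]"

definition detect :: "bool \<Rightarrow> bool \<Rightarrow> bool \<Rightarrow> bool \<Rightarrow> bool \<Rightarrow> com" where
  "detect ba ca bc bd cd =
     Seq rank_loop (Seq (sweep 1 sort_hook) (Seq (sweep 6 (test_hook ba ca bc bd cd))
       (Move 0 (Reg 7))))"

text \<open>
  The list of \<open>b\<close> contains \<open>c\<close>, which is no candidate for \<open>a\<close>, but not \<open>b\<close> itself: hence the strict
  inequality for \<open>b\<close> and the weak one for \<open>c\<close>.
\<close>

fun fails_lower :: "bound \<Rightarrow> nat \<Rightarrow> nat \<Rightarrow> nat \<Rightarrow> bool" where
  "fails_lower Unbounded rb rc i \<longleftrightarrow> False"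
| "fails_lower At_b rb rc i \<longleftrightarrow> i < rb"
| "fails_lower At_c rb rc i \<longleftrightarrow> i \<le> rc"

fun meets_upper :: "bound \<Rightarrow> nat \<Rightarrow> nat \<Rightarrow> nat \<Rightarrow> bool" where
  "meets_upper Unbounded rb rc i \<longleftrightarrow> True"
| "meets_upper At_b rb rc i \<longleftrightarrow> i < rb"
| "meets_upper At_c rb rc i \<longleftrightarrow> i < rc"

text \<open>Monotonicity makes the vertices satisfying the condition an initial segment of a sorted
  list, so that counting them gives an index.\<close>

lemma antimono_fails_lower: "antimono (fails_lower m rb rc)"
proof (rule antimonoI)
  fix i j :: nat
  assume "i \<le> j"
  then show "fails_lower m rb rc j \<le> fails_lower m rb rc i" by (cases m) auto
qed

lemma antimono_meets_upper: "antimono (meets_upper m rb rc)"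
proof (rule antimonoI)
  fix i j :: nat
  assume "i \<le> j"
  then show "meets_upper m rb rc j \<le> meets_upper m rb rc i" by (cases m) auto
qed

section \<open>Exchanging the ends of an occurrence\<close>

lemma order_ok_bounds:
  assumes "order_ok ba ca bc bd cd ra rb rc rd"
  shows "\<not> fails_lower (lower ba ca bc) rb rc ra" "meets_upper (upper bc bd cd) rb rc rd"
  using assms by (auto simp: order_ok_def lower_def upper_def lt_flag_def split: if_splits)

text \<open>Moving \<open>a\<close> down and \<open>d\<close> up preserves \<open>a\<close> before
  \<open>d\<close> and all relations pointing in the direction of the move. The others are protected
  by the bounds: being beyond the nearer of two obstacles implies being beyond the farther one,
  whose relative order is recorded by \<open>bc\<close>.\<close>

lemma order_ok_exchange:
  assumes "order_ok ba ca bc bd cd ra rb rc rd"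
    and "\<not> fails_lower (lower ba ca bc) rb rc ra'" "ra' \<le> ra" "ra' \<noteq> rb"
    and "meets_upper (upper bc bd cd) rb rc rd'" "rd \<le> rd'" "rd' \<noteq> rc"
  shows "order_ok ba ca bc bd cd ra' rb rc rd'"
proof -
  have ab: "lt_flag ba rb ra' \<and> lt_flag ca rc ra'"
    using assms(1-4) by (auto simp: order_ok_def lower_def lt_flag_def split: if_splits)
  have dc: "lt_flag bd rb rd' \<and> lt_flag cd rc rd'"
    using assms(1,5-7) by (auto simp: order_ok_def upper_def lt_flag_def split: if_splits)
  show ?thesis
    using assms(1,3,6) ab dc by (simp add: order_ok_def)
qed

section \<open>Sorted adjacency lists\<close>

locale graph_input =
  fixes adj :: "nat list list" and vs :: "nat list" and G :: "nat ordered_graph"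
  assumes graph: "is_ordered_graph G" and input: "represents adj vs G"
begin

definition n :: nat where "n = length adj"

definition N :: "nat \<Rightarrow> nat set" where "N v = {w. {v, w} \<in> edges G}"

definition st :: "nat \<Rightarrow> nat" where "st v = sum_list (map length (take v adj))"

definition rk :: "nat \<Rightarrow> nat" where "rk v = (THE i. i < n \<and> vs ! i = v)"

text \<open>For a neighbour \<open>x\<close> of \<open>b\<close> this is the index of
  \<open>x\<close> in the sorted list of \<open>b\<close>; for any other \<open>x\<close>, in
  particular \<open>b\<close> itself, the index at which it would be inserted.\<close>

definition pos :: "nat \<Rightarrow> nat \<Rightarrow> nat" where
  "pos b x = st b + card {w \<in> N b. rk w < rk x}"

lemma verts_eq: "verts G = {..<n}"
  using input by (simp add: represents_def n_def)

lemma N_sym: "w \<in> N v \<Longrightarrow> v \<in> N w"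
  by (simp add: N_def insert_commute)

lemma N_bound: "w \<in> N v \<Longrightarrow> v < n \<and> w < n \<and> v \<noteq> w"
proof -
  assume "w \<in> N v"
  then have "{v, w} \<in> pairs_of {..<n}"
    using graph by (auto simp: N_def is_ordered_graph_def verts_eq)
  then show ?thesis
    unfolding pairs_of_def by (auto simp: doubleton_eq_iff)
qed

lemma finite_N [simp]: "finite (N v)"
  using N_bound by (intro finite_subset[of "N v" "{..<n}"]) auto

lemma set_adj: "v < n \<Longrightarrow> set (adj ! v) = N v"
  and distinct_adj: "v < n \<Longrightarrow> distinct (adj ! v)"
  using input by (auto simp: represents_def n_def N_def)

lemma length_adj: "v < n \<Longrightarrow> length (adj ! v) = card (N v)"
  using set_adj distinct_adj by (metis distinct_card)

lemma vs: "distinct vs" "set vs = {..<n}" "length vs = n"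
proof -
  show 1: "distinct vs" "set vs = {..<n}"
    using input verts_eq by (auto simp: represents_def)
  show "length vs = n"
    using distinct_card[OF 1(1)] 1(2) by simp
qed

lemma vs_bound: "i < n \<Longrightarrow> vs ! i < n"
  using vs by (metis lessThan_iff nth_mem)

lemma rk_vs: "i < n \<Longrightarrow> rk (vs ! i) = i"
  unfolding rk_def using vs(1,3) by (intro the_equality) (auto simp: nth_eq_iff_index_eq)

lemma rk: "v < n \<Longrightarrow> rk v < n \<and> vs ! rk v = v"
proof -
  assume "v < n"
  then obtain i where "i < n" "vs ! i = v"
    using vs by (metis in_set_conv_nth lessThan_iff)
  then show ?thesis using rk_vs[of i] by simp
qed

lemma rk_eq_iff: "u < n \<Longrightarrow> v < n \<Longrightarrow> rk u = rk v \<longleftrightarrow> u = v"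
  using rk by metis

lemma vord_iff: "u < n \<Longrightarrow> v < n \<Longrightarrow> (u, v) \<in> vord G \<longleftrightarrow> rk u \<le> rk v"
proof -
  assume uv: "u < n" "v < n"
  have eq: "vord G = {(vs ! i, vs ! j) | i j. i \<le> j \<and> j < n}"
    using input vs by (simp add: represents_def)
  show ?thesis
  proof (intro iffI)
    assume "(u, v) \<in> vord G"
    then obtain i j where "u = vs ! i" "v = vs ! j" "i \<le> j" "j < n"
      using eq by blast
    then show "rk u \<le> rk v" using rk_vs by simp
  next
    assume "rk u \<le> rk v"
    moreover have "u = vs ! rk u" "v = vs ! rk v" "rk v < n" using uv rk by simp_all
    ultimately show "(u, v) \<in> vord G" using eq by blast
  qed
qed

section \<open>Layout of the concatenated adjacency lists\<close>

lemma st_0 [simp]: "st 0 = 0"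
  by (simp add: st_def)

lemma st_Suc: "v < n \<Longrightarrow> st (Suc v) = st v + card (N v)"
  by (simp add: st_def take_Suc_conv_app_nth length_adj flip: n_def)

lemma st_mono: "u \<le> v \<Longrightarrow> v \<le> n \<Longrightarrow> st u \<le> st v"
  by (induction v rule: dec_induct) (auto simp: st_Suc)

lemma st_n: "st n = length (concat adj)"
  by (simp add: st_def n_def length_concat)

lemma concat_adj_nth:
  assumes "v < n" "j < card (N v)"
  shows "concat adj ! (st v + j) = adj ! v ! j"
proof -
  have "concat adj = concat (take v adj) @ adj ! v @ concat (drop (Suc v) adj)"
    using assms(1) id_take_nth_drop[of v adj] by (metis concat.simps(2) concat_append n_def)
  moreover have "length (concat (take v adj)) = st v"
    by (simp add: st_def length_concat)
  ultimately show ?thesis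
    using assms by (simp add: nth_append length_adj)
qed

lemma st_le: "v < n \<Longrightarrow> st v + card (N v) \<le> st n"
  using st_mono[of "Suc v" n] by (simp add: st_Suc)

lemma st_n_eq: "st n = (\<Sum>v<n. card (N v))"
proof -
  have "st k = (\<Sum>v<k. card (N v))" if "k \<le> n" for k
    using that by (induction k) (auto simp: st_Suc)
  then show ?thesis by simp
qed

text \<open>The total length of the lists is the number of ordered pairs of adjacent vertices, and
  each edge \<open>e\<close> has at most two orderings, collected in \<open>D e\<close>.\<close>

lemma st_n_le: "st n \<le> 2 * card (edges G)"
proof -
  have fin: "finite (edges G)"
  proof -
    have "edges G \<subseteq> Pow {..<n}"
      using graph by (auto simp: is_ordered_graph_def pairs_of_def verts_eq)
    then show ?thesis by (rule finite_subset) simp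
  qed
  define D :: "nat set \<Rightarrow> (nat \<times> nat) set" where "D e = {(v, w). {v, w} = e}" for e
  have le2: "finite (D e) \<and> card (D e) \<le> 2" if e: "e \<in> edges G" for e
  proof -
    obtain x y where "e = {x, y}"
      using graph e by (auto simp: is_ordered_graph_def pairs_of_def)
    then have sub: "D e \<subseteq> {(x, y), (y, x)}" by (auto simp: D_def doubleton_eq_iff)
    then have "card (D e) \<le> card {(x, y), (y, x)}" by (intro card_mono) auto
    also have "\<dots> \<le> 2" using card_length[of "[(x, y), (y, x)]"] by simp
    finally show ?thesis using finite_subset[OF sub] by blast
  qed
  have "st n = card (Sigma {..<n} N)"
    by (simp add: st_n_eq)
  also have "\<dots> \<le> card (\<Union>e\<in>edges G. D e)"
    using fin le2 by (intro card_mono) (auto simp: N_def D_def)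
  also have "\<dots> \<le> (\<Sum>e\<in>edges G. card (D e))"
    by (rule card_UN_le[OF fin])
  also have "\<dots> \<le> (\<Sum>e\<in>edges G. 2)"
    using le2 by (intro sum_mono) auto
  finally show ?thesis by simp
qed

section \<open>Places in the sorted lists\<close>

lemma pos_less: "x \<in> N b \<Longrightarrow> pos b x < st b + card (N b)"
proof -
  assume "x \<in> N b"
  then have "{w \<in> N b. rk w < rk x} \<subset> N b" by blast
  then have "card {w \<in> N b. rk w < rk x} < card (N b)" by (rule psubset_card_mono[OF finite_N])
  then show ?thesis by (simp add: pos_def)
qed

lemma pos_mono:
  assumes "x \<in> N b" "rk x < rk y"
  shows "pos b x < pos b y"
proof -
  have "{w \<in> N b. rk w < rk x} \<subset> {w \<in> N b. rk w < rk y}"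
    using assms by (auto simp: psubset_eq)
  then have "card {w \<in> N b. rk w < rk x} < card {w \<in> N b. rk w < rk y}"
    by (intro psubset_card_mono) auto
  then show ?thesis by (simp add: pos_def)
qed

lemma pos_inj_on: "inj_on (pos b) (N b)"
proof (rule inj_onI)
  fix x y assume xy: "x \<in> N b" "y \<in> N b" "pos b x = pos b y"
  then have "rk x = rk y"
    using pos_mono[of x b y] pos_mono[of y b x] by (metis less_irrefl linorder_neqE_nat)
  then show "x = y" using xy N_bound rk_eq_iff by metis
qed

text \<open>An injection into an interval of the same size is onto.\<close>

lemma pos_image: "pos b ` N b = {st b..<st b + card (N b)}"
proof (rule card_subset_eq)
  show "pos b ` N b \<subseteq> {st b..<st b + card (N b)}"
    using pos_less by (auto simp: pos_def)
  show "card (pos b ` N b) = card {st b..<st b + card (N b)}"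
    by (simp add: card_image[OF pos_inj_on])
qed simp

text \<open>Different lists occupy disjoint intervals, and within one list places are distinct.
  Hence a place determines both its list and its entry.\<close>

lemma pos_eq:
  assumes "x \<in> N b" "x' \<in> N b'" "pos b x = pos b' x'"
  shows "b = b' \<and> x = x'"
proof -
  have *: "\<not> u < v" if "y \<in> N u" "z \<in> N v" "pos u y = pos v z" for u v y z
  proof
    assume "u < v"
    then have "st (Suc u) \<le> st v" using N_bound[OF that(2)] st_mono[of "Suc u" v] by simp
    then show False
      using pos_less[OF that(1)] that(3) N_bound[OF that(1)] by (auto simp: st_Suc pos_def)
  qed
  have "b = b'" using * assms by (metis linorder_neqE_nat)
  then show ?thesis using assms pos_inj_on by (auto dest: inj_onD)
qed

lemma pos_ex:
  assumes "st v \<le> p" "p < st v + card (N v)"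
  obtains w where "w \<in> N v" "pos v w = p"
proof -
  have "p \<in> pos v ` N v" unfolding pos_image using assms by simp
  then show ?thesis using that by blast
qed

text \<open>The neighbours satisfying \<open>R\<close> fill the sorted list up to \<open>q\<close>,
  so \<open>q\<close> is the index of the first one violating \<open>R\<close>, or the end of the
  list.\<close>

lemma first_not:
  assumes R: "antimono R"
    and q: "q = st v + card {w \<in> N v. R (rk w)}"
  shows "if q < st v + card (N v)
    then \<exists>w\<in>N v. pos v w = q \<and> \<not> R (rk w) \<and> (\<forall>u\<in>N v. \<not> R (rk u) \<longrightarrow> rk w \<le> rk u)
    else \<forall>u\<in>N v. R (rk u)"
proof (cases "q < st v + card (N v)")
  have down: "R i" if "i \<le> j" "R j" for i j
    using antimonoD[OF R that(1)] that(2) by simp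
  case True
  have "st v \<le> q" using q by simp
  then obtain w where w: "w \<in> N v" "pos v w = q"
    using True by (rule pos_ex)
  have eq: "card {u \<in> N v. rk u < rk w} = card {u \<in> N v. R (rk u)}"
    using q w by (simp add: pos_def)
  have nR: "\<not> R (rk w)"
  \<comment> \<open>Otherwise \<open>w\<close> and all neighbours before it satisfy
    \<open>R\<close>, one more than \<open>eq\<close> allows.\<close>
  proof
    assume R: "R (rk w)"
    then have "R (rk y)" if "rk y < rk w" for y
      using down[of "rk y" "rk w"] that by simp
    then have "{u \<in> N v. rk u < rk w} \<subset> {u \<in> N v. R (rk u)}"
      using w R by blast
    then have "card {u \<in> N v. rk u < rk w} < card {u \<in> N v. R (rk u)}"
      by (intro psubset_card_mono) auto
    then show False using eq by simp
  qed
  have "rk w \<le> rk u" if u: "u \<in> N v" "\<not> R (rk u)" for u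
  proof (rule ccontr)
    assume "\<not> rk w \<le> rk u"
    moreover have "rk y < rk u" if "R (rk y)" for y
      using down[of "rk u" "rk y"] that u by (meson not_less)
    ultimately have "rk y < rk w \<and> y \<noteq> u" if "R (rk y)" for y
      using that u by (metis less_trans not_le)
    then have "{u \<in> N v. R (rk u)} \<subseteq> {u \<in> N v. rk u < rk w} - {u}"
      by blast
    moreover have "u \<in> {u \<in> N v. rk u < rk w}"
      using u \<open>\<not> rk w \<le> rk u\<close> by simp
    ultimately have "{u \<in> N v. R (rk u)} \<subset> {u \<in> N v. rk u < rk w}"
      by blast
    then have "card {u \<in> N v. R (rk u)} < card {u \<in> N v. rk u < rk w}"
      by (intro psubset_card_mono) auto
    then show False using eq by simp
  qed
  then show ?thesis using True w nR by auto
next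
  case False
  then have "card {w \<in> N v. R (rk w)} \<ge> card (N v)" using q by simp
  then have "{w \<in> N v. R (rk w)} = N v" by (intro card_seteq) auto
  then show ?thesis using False by auto
qed

text \<open>The same initial segment ends just before \<open>q\<close>, so its last member has index
  \<open>q - 1\<close> unless the segment is empty.\<close>

lemma last_such:
  assumes R: "antimono R"
    and q: "q = st v + card {w \<in> N v. R (rk w)}"
  shows "if st v < q
    then \<exists>w\<in>N v. pos v w = q - 1 \<and> R (rk w) \<and> (\<forall>u\<in>N v. R (rk u) \<longrightarrow> rk u \<le> rk w)
    else \<forall>u\<in>N v. \<not> R (rk u)"
proof (cases "st v < q")
  have down: "R i" if "i \<le> j" "R j" for i j
    using antimonoD[OF R that(1)] that(2) by simp
  case True
  have "card {w \<in> N v. R (rk w)} \<le> card (N v)" by (rule card_mono) auto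
  then have "q \<le> st v + card (N v)" using q by simp
  then have "st v \<le> q - 1" "q - 1 < st v + card (N v)" using True by auto
  then obtain w where w: "w \<in> N v" "pos v w = q - 1" by (rule pos_ex)
  have eq: "Suc (card {u \<in> N v. rk u < rk w}) = card {u \<in> N v. R (rk u)}"
    using q w True by (simp add: pos_def)
  have R: "R (rk w)"
  proof (rule ccontr)
    assume nR: "\<not> R (rk w)"
    have "rk y < rk w" if "R (rk y)" for y
      using down[of "rk w" "rk y"] that nR by (meson not_less)
    then have "{u \<in> N v. R (rk u)} \<subseteq> {u \<in> N v. rk u < rk w}" by auto
    then have "card {u \<in> N v. R (rk u)} \<le> card {u \<in> N v. rk u < rk w}"
      by (intro card_mono) auto
    then show False using eq by simp
  qed
  have "rk u \<le> rk w" if u: "u \<in> N v" "R (rk u)" for u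
  proof (rule ccontr)
    assume gt: "\<not> rk u \<le> rk w"
    have "R (rk y)" if "rk y < rk w" for y
      using down[of "rk y" "rk w"] that R by simp
    \<comment> \<open>Two vertices beyond those before \<open>w\<close> would satisfy
      \<open>R\<close>, while \<open>eq\<close> leaves room for one.\<close>
    then have "insert u (insert w {y \<in> N v. rk y < rk w}) \<subseteq> {u \<in> N v. R (rk u)}"
      using R u w by auto
    then have "card (insert u (insert w {y \<in> N v. rk y < rk w})) \<le> card {u \<in> N v. R (rk u)}"
      by (intro card_mono) auto
    moreover have "u \<noteq> w" using gt by auto
    ultimately show False using eq gt by simp
  qed
  then show ?thesis using True w R by auto
next
  case False
  then have "card {w \<in> N v. R (rk w)} = 0" using q by simp
  then have "{w \<in> N v. R (rk w)} = {}" by simp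
  then show ?thesis using False by auto
qed

subsection \<open>Sweeps\<close>

definition base :: "state \<Rightarrow> bool" where
  "base s \<longleftrightarrow> regs s 0 = n \<and> (\<forall>v\<le>n. arrs s 0 v = st v) \<and>
     (\<forall>p<st n. arrs s 1 p = concat adj ! p) \<and> (\<forall>i<n. arrs s 2 i = vs ! i)"

definition ranked :: "state \<Rightarrow> bool" where
  "ranked s \<longleftrightarrow> (\<forall>v<n. arrs s 3 v = rk v)"

text \<open>
  The pairs handled by a sweep over the lists \<open>f\<close> when it reaches entry \<open>p\<close> of the list of the vertex
  of rank \<open>i\<close>.
\<close>

definition visited :: "(nat \<Rightarrow> nat) \<Rightarrow> nat \<Rightarrow> nat \<Rightarrow> (nat \<times> nat) set" where
  "visited f i p =
     {(x, b). b \<in> N x \<and> (rk x < i \<or> rk x = i \<and> b \<in> f ` {st x..<p})}"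

definition arcs :: "(nat \<times> nat) set" where "arcs = {(x, b). b \<in> N x}"

text \<open>Input lists and sorted lists share the boundaries \<open>st\<close>, so one analysis of
  a sweep covers both.\<close>

definition lists_neighbours :: "(nat \<Rightarrow> nat) \<Rightarrow> bool" where
  "lists_neighbours f \<longleftrightarrow> (\<forall>x<n. bij_betw f {st x..<st x + card (N x)} (N x))"

lemma visited_0: "visited f 0 0 = {}"
  by (auto simp: visited_def)

lemma visited_n: "visited f n 0 = arcs"
proof -
  have "rk x < n" if "b \<in> N x" for x b
    using N_bound[OF that] rk[of x] by simp
  then show ?thesis by (auto simp: visited_def arcs_def)
qed

lemma visited_iff:
  assumes "i < n"
  shows "(x, b) \<in> visited f i p \<longleftrightarrow>
    b \<in> N x \<and> (rk x < i \<or> x = vs ! i \<and> b \<in> f ` {st (vs ! i)..<p})"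
proof (cases "b \<in> N x")
  case True
  then have "rk x = i \<longleftrightarrow> x = vs ! i"
    using N_bound[OF True] rk[of x] rk_vs[OF assms] by auto
  then show ?thesis using True by (auto simp: visited_def)
qed (simp add: visited_def)

lemma visited_start: "i < n \<Longrightarrow> visited f i (st (vs ! i)) = visited f i 0"
  by (intro set_eqI) (simp add: split_paired_all visited_iff)

lemma visited_end:
  assumes f: "lists_neighbours f" and i: "i < n"
  shows "visited f i (st (vs ! i) + card (N (vs ! i))) = visited f (Suc i) 0"
proof -
  have image: "f ` {st (vs ! i)..<st (vs ! i) + card (N (vs ! i))} = N (vs ! i)"
    using f vs_bound[OF i] by (simp add: lists_neighbours_def bij_betw_def)
  have "(x, b) \<in> visited f i (st (vs ! i) + card (N (vs ! i))) \<longleftrightarrow>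
      (x, b) \<in> visited f (Suc i) 0" for x b
  proof (cases "b \<in> N x")
    case True
    then have "rk x = i \<longleftrightarrow> x = vs ! i"
      using N_bound[OF True] rk[of x] rk_vs[OF i] by auto
    then show ?thesis
      using True image by (auto simp: visited_iff[OF i] visited_def less_Suc_eq)
  qed (simp add: visited_def)
  then show ?thesis by (intro set_eqI) (simp add: split_paired_all)
qed

text \<open>The last two equations locate the cursors. Just before the pair is handled, the list of
  \<open>f p\<close> has met its neighbours of rank below \<open>i\<close>; the vertex being visited
  is absent from its own list, so its own cursor rests during the visit.\<close>

lemma visited_step:
  assumes f: "lists_neighbours f" and i: "i < n"
    and p: "st (vs ! i) \<le> p" "p < st (vs ! i) + card (N (vs ! i))"
  shows "f p \<in> N (vs ! i)"
    and "visited f i (Suc p) = insert (vs ! i, f p) (visited f i p)"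
    and "(vs ! i, f p) \<notin> visited f i p"
    and "{y. (y, f p) \<in> visited f i p} = {y \<in> N (f p). rk y < i}"
    and "{y. (y, vs ! i) \<in> visited f i p} = {y \<in> N (vs ! i). rk y < i}"
proof -
  let ?x = "vs ! i"
  have x: "?x < n" "rk ?x = i" using i vs_bound rk_vs by auto
  have bij: "bij_betw f {st ?x..<st ?x + card (N ?x)} (N ?x)"
    using f x(1) by (auto simp: lists_neighbours_def)
  then show fp: "f p \<in> N ?x" using p by (auto simp: bij_betw_def)
  have "{st ?x..<Suc p} = insert p {st ?x..<p}" using p by auto
  then show "visited f i (Suc p) = insert (?x, f p) (visited f i p)"
    using fp by (intro set_eqI) (auto simp: visited_iff[OF i] split_paired_all)
  have new: "f p \<notin> f ` {st ?x..<p}"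
  proof
    assume "f p \<in> f ` {st ?x..<p}"
    then obtain q where "q \<in> {st ?x..<p}" "f p = f q" by blast
    then show False
      using inj_onD[OF bij_betw_imp_inj_on[OF bij], of p q] p by auto
  qed
  then show "(?x, f p) \<notin> visited f i p"
    using x by (simp add: visited_iff[OF i])
  have sym: "a \<in> N c \<longleftrightarrow> c \<in> N a" for a c using N_sym by blast
  have "(y, f p) \<in> visited f i p \<longleftrightarrow> y \<in> N (f p) \<and> rk y < i" for y
    using new sym[of "f p" y] unfolding visited_iff[OF i] by blast
  then show "{y. (y, f p) \<in> visited f i p} = {y \<in> N (f p). rk y < i}" by simp
  have "?x \<notin> N ?x" using N_bound by blast
  then have "(y, ?x) \<in> visited f i p \<longleftrightarrow> y \<in> N ?x \<and> rk y < i" for y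
    using sym[of ?x y] unfolding visited_iff[OF i] by blast
  then show "{y. (y, ?x) \<in> visited f i p} = {y \<in> N ?x. rk y < i}" by simp
qed

text \<open>The cursor of \<open>b\<close> counts the handled pairs with second component
  \<open>b\<close>. \<open>K\<close> is the invariant of the hook, which owns arrays 5 and 6 and
  register 7.\<close>

definition sweep_inv where
  "sweep_inv f K i p s \<longleftrightarrow> base s \<and> ranked s \<and> regs s 1 = i \<and>
     (\<forall>b<n. arrs s 4 b = st b + card {x. (x, b) \<in> visited f i p}) \<and>
     K (visited f i p) (arrs s 5) (arrs s 6) (regs s 7)"

definition hook_pre where
  "hook_pre f x b p s \<longleftrightarrow> base s \<and> ranked s \<and> x < n \<and> b \<in> N x \<and>
     regs s 2 = x \<and> regs s 3 = p \<and> regs s 4 = st x + card (N x) \<and> regs s 5 = b \<and>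
     regs s 6 = pos b x \<and> arrs s 4 x = pos x x \<and>
     st x \<le> p \<and> p < st x + card (N x) \<and> f p = b"

definition frame :: "state \<Rightarrow> state \<Rightarrow> bool" where
  "frame s s' \<longleftrightarrow> (\<forall>r<7. regs s' r = regs s r) \<and> (\<forall>a<5. arrs s' a = arrs s a)"

lemma sum_degrees: "(\<Sum>i<n. card (N (vs ! i))) = st n"
proof -
  have "bij_betw ((!) vs) {..<n} {..<n}"
    by (rule bij_betw_nth) (simp_all add: vs)
  then show ?thesis
    unfolding st_n_eq by (rule sum.reindex_bij_betw)
qed

section \<open>Correctness and running time of the loops\<close>

lemma rank_loop:
  assumes B: "n < B" and s: "base s"
  shows "terminates B rank_loop s (2 + 4 * n)
    (\<lambda>s'. base s' \<and> ranked s' \<and> (\<forall>r. r \<notin> {1, 2} \<longrightarrow> regs s' r = regs s r))"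
proof -
  define I where "I i s' \<longleftrightarrow> base s' \<and> (\<forall>j<i. arrs s' 3 (vs ! j) = j) \<and> regs s' 1 = i \<and>
    (\<forall>r. r \<notin> {1, 2} \<longrightarrow> regs s' r = regs s r)" for i s'
  have 1: "terminates B (Move 1 (Const 0)) s 1 (I 0)"
    using terminates_wp[of B "Move 1 (Const 0)" "I 0" s] B s by (simp add: I_def base_def)
  let ?p = "block [Load 2 2 (Reg 1), Store 3 (Reg 2) (Reg 1), Add 1 (Reg 1) (Const 1)]"
  have 2: "terminates B (While (Less (Reg 1) (Reg 0)) ?p) s1 (1 + (\<Sum>k=0..<n. 1 + 3)) (I n)"
    if "I 0 s1" for s1
  proof (rule terminates_For[where I = I])
    fix k s' assume k: "k < n" and I: "I k s'"
    \<comment> \<open>Writing the rank of \<open>vs ! k\<close> leaves the earlier ranks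
      intact.\<close>
    have "vs ! j \<noteq> vs ! k" if "j < k" for j
      using that k vs by (simp add: nth_eq_iff_index_eq)
    then have "wp B ?p (I (Suc k)) s'"
      using k I B vs_bound[OF k] by (auto simp: I_def base_def less_Suc_eq)
    then have "terminates B ?p s' 3 (I (Suc k))" by (rule terminates_wpI) simp
    then show "holds s' (Less (Reg 1) (Reg 0)) \<and> terminates B ?p s' 3 (I (Suc k))"
      using I k by (simp add: I_def base_def del: block.simps)
  qed (use that in \<open>auto simp: I_def base_def\<close>)
  have I_ranked: "ranked s'" if "I n s'" for s'
    unfolding ranked_def
  proof (intro allI impI)
    fix v assume "v < n"
    from rk[OF this] have v: "rk v < n" "vs ! rk v = v" by auto
    have "arrs s' 3 (vs ! rk v) = rk v" using that v(1) unfolding I_def by blast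
    then show "arrs s' 3 v = rk v" using v(2) by simp
  qed
  show ?thesis
    unfolding rank_loop_def
    by (rule terminates_mono[OF terminates_Seq[OF 1 2]])
      (use I_ranked in \<open>auto simp: I_def\<close>)
qed

lemma reset_loop:
  assumes B: "n < B" "st n < B" and s: "base s" "ranked s"
  shows "terminates B reset_loop s (2 + 4 * n)
    (\<lambda>s'. base s' \<and> ranked s' \<and> (\<forall>v<n. arrs s' 4 v = st v) \<and>
       regs s' 7 = regs s 7 \<and> arrs s' 5 = arrs s 5 \<and> arrs s' 6 = arrs s 6)"
proof -
  define I where "I i s' \<longleftrightarrow> base s' \<and> ranked s' \<and> (\<forall>j<i. arrs s' 4 j = st j) \<and> regs s' 1 = i \<and>
    regs s' 7 = regs s 7 \<and> arrs s' 5 = arrs s 5 \<and> arrs s' 6 = arrs s 6" for i s'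
  have 1: "terminates B (Move 1 (Const 0)) s 1 (I 0)"
    using terminates_wp[of B "Move 1 (Const 0)" "I 0" s] B s
    by (simp add: I_def base_def ranked_def)
  let ?p = "block [Load 2 0 (Reg 1), Store 4 (Reg 1) (Reg 2), Add 1 (Reg 1) (Const 1)]"
  have 2: "terminates B (While (Less (Reg 1) (Reg 0)) ?p) s1 (1 + (\<Sum>k=0..<n. 1 + 3)) (I n)"
    if "I 0 s1" for s1
  proof (rule terminates_For[where I = I])
    fix k s' assume k: "k < n" and I: "I k s'"
    have "st k < B" using st_mono[of k n] k B by simp
    then have "wp B ?p (I (Suc k)) s'"
      using k I B by (auto simp: I_def base_def ranked_def less_Suc_eq)
    then have "terminates B ?p s' 3 (I (Suc k))" by (rule terminates_wpI) simp
    then show "holds s' (Less (Reg 1) (Reg 0)) \<and> terminates B ?p s' 3 (I (Suc k))"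
      using I k by (simp add: I_def base_def del: block.simps)
  qed (use that in \<open>auto simp: I_def base_def\<close>)
  show ?thesis
    unfolding reset_loop_def
    by (rule terminates_mono[OF terminates_Seq[OF 1 2]]) (auto simp: I_def)
qed

text \<open>The assumption \<open>read\<close> may use \<open>K\<close>, since the second sweep
  reads lists that only the invariant of its hook describes. Besides the reset, a vertex costs 7
  steps (two loop tests, four loads and additions, one increment) and an entry 6 plus the
  hook.\<close>

lemma sweep:
  assumes B: "n < B" "st n < B" and f: "lists_neighbours f"
    and read: "\<And>s V x p. base s \<Longrightarrow> K V (arrs s 5) (arrs s 6) (regs s 7) \<Longrightarrow> x < n \<Longrightarrow> st x \<le> p \<Longrightarrow>
      p < st x + card (N x) \<Longrightarrow> arrs s src p = f p"
    and hook: "\<And>s x b p V. hook_pre f x b p s \<Longrightarrow> K V (arrs s 5) (arrs s 6) (regs s 7) \<Longrightarrow>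
      wp B hook (\<lambda>s'. frame s s' \<and>
        K (insert (x, b) V) (arrs s' 5) (arrs s' 6) (regs s' 7)) s"
    and s: "base s" "ranked s" "K {} (arrs s 5) (arrs s 6) (regs s 7)"
  shows "terminates B (sweep src hook) s (4 + 11 * n + (6 + cost hook) * st n)
    (\<lambda>s'. base s' \<and> ranked s' \<and> K arcs (arrs s' 5) (arrs s' 6) (regs s' 7))"
proof -
  let ?init = "block [Load 2 2 (Reg 1), Load 3 0 (Reg 2), Add 4 (Reg 2) (Const 1),
    Load 4 0 (Reg 4)]"
  let ?fetch = "block [Load 5 src (Reg 3), Load 6 4 (Reg 5), Add 8 (Reg 6) (Const 1),
    Store 4 (Reg 5) (Reg 8)]"
  let ?body = "Seq ?fetch (Seq hook (Add 3 (Reg 3) (Const 1)))"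
  let ?inner = "While (Less (Reg 3) (Reg 4)) ?body"
  define J where "J i p s' \<longleftrightarrow> sweep_inv f K i p s' \<and> regs s' 2 = vs ! i \<and> regs s' 3 = p \<and>
    regs s' 4 = st (vs ! i) + card (N (vs ! i))" for i p s'
  have init: "terminates B ?init s' 4 (J i (st (vs ! i)))"
    if i: "i < n" and I: "sweep_inv f K i 0 s'" for i s'
  proof -
    have x: "vs ! i < n" using vs_bound i by simp
    have "st (vs ! i) < B" "st (vs ! i) + card (N (vs ! i)) < B" using st_le[OF x] B by auto
    then have "wp B ?init (J i (st (vs ! i))) s'"
      using i I x B visited_start[OF i, of f]
      by (auto simp: J_def sweep_inv_def base_def ranked_def st_Suc)
    then show ?thesis by (rule terminates_wpI) simp
  qed
  have body: "terminates B ?body s' (5 + cost hook) (J i (Suc p))"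
    if i: "i < n" and p: "st (vs ! i) \<le> p" "p < st (vs ! i) + card (N (vs ! i))"
      and I: "J i p s'" for i p s'
  proof -
    define x where "x = vs ! i"
    define b where "b = f p"
    define V where "V = visited f i p"
    note step = visited_step[OF f i p, folded x_def b_def V_def]
    have x: "x < n" "rk x = i" using i vs_bound rk_vs by (auto simp: x_def)
    have b: "b < n" "x \<noteq> b" "x \<in> N b" using N_bound[OF step(1)] N_sym step(1) by auto
    have pn: "p < st n" using p st_le[OF x(1)] by (simp add: x_def)
    have I': "base s'" "ranked s'" "regs s' 1 = i" "K V (arrs s' 5) (arrs s' 6) (regs s' 7)"
      "regs s' 2 = x" "regs s' 3 = p" "regs s' 4 = st x + card (N x)"
      and cur: "\<And>v. v < n \<Longrightarrow> arrs s' 4 v = st v + card {y. (y, v) \<in> V}"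
      using I by (auto simp: J_def sweep_inv_def x_def V_def)
    have cur_b: "arrs s' 4 b = pos b x" using cur[OF b(1)] step(4) x by (simp add: pos_def)
    have cur_x: "arrs s' 4 x = pos x x" using cur[OF x(1)] step(5) x by (simp add: pos_def)
    have rd: "arrs s' src p = b" using read[OF I'(1,4) x(1)] p by (simp add: b_def x_def)
    have lt: "Suc (pos b x) \<le> st n" using pos_less[OF b(3)] st_le[OF b(1)] by simp
    \<comment> \<open>The state after the fetch: the cursor of \<open>b\<close> has already moved
      on, and register 6 keeps its old value.\<close>
    define s1 where "s1 = set_arr 4 b (Suc (pos b x)) (set_reg 8 (Suc (pos b x))
      (set_reg 6 (pos b x) (set_reg 5 b s')))"
    have pre: "hook_pre f x b p s1"
      using I' p b x step(1) cur_x
      by (auto simp: hook_pre_def s1_def base_def ranked_def x_def b_def)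
    have after: "J i (Suc p) (set_reg 3 (Suc p) s2)"
      if fr: "frame s1 s2" and K: "K (insert (x, b) V) (arrs s2 5) (arrs s2 6) (regs s2 7)" for s2
    proof -
      have fin: "finite {y. (y, b) \<in> V}" using step(4) by simp
      \<comment> \<open>The pair is new, so the count for \<open>b\<close> grows by exactly one and
        no other count changes.\<close>
      have "{y. (y, b) \<in> insert (x, b) V} = insert x {y. (y, b) \<in> V}" by auto
      then have card_b: "card {y. (y, b) \<in> insert (x, b) V} = Suc (card {y. (y, b) \<in> V})"
        using fin step(3) by simp
      have other: "{y. (y, v) \<in> insert (x, b) V} = {y. (y, v) \<in> V}" if "v \<noteq> b" for v
        using that by auto
      have "arrs s2 4 v = st v + card {y. (y, v) \<in> insert (x, b) V}" if "v < n" for v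
      proof (cases "v = b")
        case True
        then show ?thesis
          using fr card_b cur[OF b(1)] cur_b by (simp add: frame_def s1_def)
      next
        case False
        then show ?thesis
          using fr cur[OF that] unfolding other[OF False] by (simp add: frame_def s1_def)
      qed
      moreover have "base s2" "ranked s2"
        using I'(1,2) fr by (auto simp: base_def ranked_def frame_def s1_def)
      ultimately show ?thesis
        using I' K fr unfolding J_def sweep_inv_def step(2)[unfolded V_def] x_def[symmetric] V_def
        by (auto simp: base_def ranked_def frame_def s1_def step(2))
    qed
    have "wp B hook (\<lambda>s2. frame s1 s2 \<and>
        K (insert (x, b) V) (arrs s2 5) (arrs s2 6) (regs s2 7)) s1"
      by (rule hook[OF pre]) (use I' in \<open>simp add: s1_def\<close>)
    then have "wp B hook (wp B (Add 3 (Reg 3) (Const 1)) (J i (Suc p))) s1"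
    proof (rule wp_mono)
      fix s2
      assume s2: "frame s1 s2 \<and> K (insert (x, b) V) (arrs s2 5) (arrs s2 6) (regs s2 7)"
      then have "regs s2 3 = p" using I' by (simp add: frame_def s1_def)
      then show "wp B (Add 3 (Reg 3) (Const 1)) (J i (Suc p)) s2"
        using after s2 pn B by simp
    qed
    then have "wp B ?body (J i (Suc p)) s'"
      using B pn lt b(1) by (simp add: I' rd cur_b s1_def)
    then show ?thesis by (rule terminates_wpI) simp
  qed
  have inner: "terminates B ?inner s' (1 + (6 + cost hook) * card (N (vs ! i)))
      (sweep_inv f K i (st (vs ! i) + card (N (vs ! i))))"
    if i: "i < n" and I: "J i (st (vs ! i)) s'" for i s'
  proof -
    let ?a = "st (vs ! i)" and ?b = "st (vs ! i) + card (N (vs ! i))"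
    have "terminates B ?inner s' (1 + (\<Sum>p=?a..<?b. 1 + (5 + cost hook))) (J i ?b)"
    proof (rule terminates_For[where I = "J i"])
      fix p s' assume p: "?a \<le> p" "p < ?b" and Ip: "J i p s'"
      then show "holds s' (Less (Reg 3) (Reg 4)) \<and>
          terminates B ?body s' (5 + cost hook) (J i (Suc p))"
        using body[OF i p Ip] by (simp add: J_def)
    qed (use I in \<open>auto simp: J_def\<close>)
    then show ?thesis
      by (rule terminates_mono) (auto simp: J_def algebra_simps)
  qed
  let ?step = "Seq ?init (Seq ?inner (Add 1 (Reg 1) (Const 1)))"
  let ?T = "\<lambda>i. 6 + (6 + cost hook) * card (N (vs ! i))"
  have step: "terminates B ?step s' (?T i) (sweep_inv f K (Suc i) 0)"
    if i: "i < n" and I: "sweep_inv f K i 0 s'" for i s'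
  proof -
    have incr: "terminates B (Add 1 (Reg 1) (Const 1)) s2 1 (sweep_inv f K (Suc i) 0)"
      if "sweep_inv f K i (st (vs ! i) + card (N (vs ! i))) s2" for s2
    proof -
      have "wp B (Add 1 (Reg 1) (Const 1)) (sweep_inv f K (Suc i) 0) s2"
        using that i B visited_end[OF f i] by (simp add: sweep_inv_def base_def ranked_def)
      then show ?thesis by (rule terminates_wpI) simp
    qed
    show ?thesis
      by (rule terminates_mono[OF
        terminates_Seq[OF init[OF i I] terminates_Seq[OF inner[OF i] incr]]]) simp_all
  qed
  have outer: "terminates B (While (Less (Reg 1) (Reg 0)) ?step) s'
      (1 + (\<Sum>i=0..<n. 1 + ?T i)) (sweep_inv f K n 0)"
    if "sweep_inv f K 0 0 s'" for s'
    by (rule terminates_For[where I = "\<lambda>i. sweep_inv f K i 0"])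
      (use that step in \<open>auto simp: sweep_inv_def base_def\<close>)
  have sum_T: "(\<Sum>i=0..<n. 1 + ?T i) = 7 * n + (6 + cost hook) * st n"
    unfolding sum_degrees[symmetric]
    by (simp add: sum.distrib sum_distrib_left atLeast0LessThan)
  have start: "terminates B (Move 1 (Const 0)) s1 1 (sweep_inv f K 0 0)"
    if "base s1 \<and> ranked s1 \<and> (\<forall>v<n. arrs s1 4 v = st v) \<and>
       regs s1 7 = regs s 7 \<and> arrs s1 5 = arrs s 5 \<and> arrs s1 6 = arrs s 6" for s1
  proof -
    have "wp B (Move 1 (Const 0)) (sweep_inv f K 0 0) s1"
      using that s(3) B by (simp add: sweep_inv_def visited_0 base_def ranked_def)
    then show ?thesis by (rule terminates_wpI) simp
  qed
  show ?thesis
    unfolding sweep_def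
    by (rule terminates_mono[OF
      terminates_Seq[OF reset_loop[OF B s(1,2)] terminates_Seq[OF start outer]]])
      (use sum_T in \<open>auto simp: sweep_inv_def visited_n\<close>)
qed

subsection \<open>Sorting and testing\<close>

lemma lists_neighbours_input: "lists_neighbours ((!) (concat adj))"
  unfolding lists_neighbours_def
proof (intro allI impI)
  fix x assume x: "x < n"
  let ?k = "card (N x)"
  have "bij_betw ((!) (adj ! x)) {..<?k} (N x)"
    by (rule bij_betw_nth) (simp_all add: x distinct_adj set_adj length_adj)
  moreover have "bij_betw (\<lambda>p. p - st x) {st x..<st x + ?k} {..<?k}"
    by (rule bij_betw_byWitness[where f' = "\<lambda>j. st x + j"]) auto
  ultimately have comp: "bij_betw ((!) (adj ! x) \<circ> (\<lambda>p. p - st x)) {st x..<st x + ?k} (N x)"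
    by (rule bij_betw_trans[rotated])
  have eq: "((!) (adj ! x) \<circ> (\<lambda>p. p - st x)) p = concat adj ! p"
    if "p \<in> {st x..<st x + ?k}" for p
  proof -
    have "p - st x < ?k" "st x + (p - st x) = p" using that by auto
    then show ?thesis using concat_adj_nth[OF x, of "p - st x"] by simp
  qed
  show "bij_betw ((!) (concat adj)) {st x..<st x + ?k} (N x)"
    by (rule bij_betw_cong[THEN iffD1, OF _ comp]) (rule eq)
qed

text \<open>The intended contents of array 6; \<open>pos_eq\<close> makes the description
  unique.\<close>

definition sorted_nbr :: "nat \<Rightarrow> nat" where
  "sorted_nbr p = (THE w. \<exists>v. w \<in> N v \<and> pos v w = p)"

lemma sorted_nbr_pos: "w \<in> N v \<Longrightarrow> sorted_nbr (pos v w) = w"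
proof -
  assume w: "w \<in> N v"
  show ?thesis
    unfolding sorted_nbr_def
  proof (rule the_equality)
    show "\<exists>v'. w \<in> N v' \<and> pos v' w = pos v w" using w by blast
    fix u
    assume "\<exists>v'. u \<in> N v' \<and> pos v' u = pos v w"
    then show "u = w" using pos_eq[OF _ w] by blast
  qed
qed

lemma lists_neighbours_sorted: "lists_neighbours sorted_nbr"
  unfolding lists_neighbours_def pos_image[symmetric]
proof (intro allI impI)
  fix v
  show "bij_betw sorted_nbr (pos v ` N v) (N v)"
    by (rule bij_betw_byWitness[where f' = "pos v"]) (auto simp: sorted_nbr_pos)
qed

text \<open>\<open>V \<subseteq> arcs\<close> rules out that later writes overwrite earlier ones.
  Register 7 stays 0 as the initial answer for the second sweep.\<close>

definition sorts :: "(nat \<times> nat) set \<Rightarrow> (nat \<Rightarrow> nat) \<Rightarrow> (nat \<Rightarrow> nat) \<Rightarrow> nat \<Rightarrow> bool" where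
  "sorts V own S r \<longleftrightarrow> V \<subseteq> arcs \<and> (\<forall>(x, b)\<in>V. S (pos b x) = x \<and> own x = pos x x) \<and> r = 0"

lemma pos_le: "b < n \<Longrightarrow> pos b x \<le> st n"
proof -
  assume b: "b < n"
  have "card {w \<in> N b. rk w < rk x} \<le> card (N b)" by (rule card_mono) auto
  then show ?thesis using st_le[OF b] by (simp add: pos_def)
qed

lemma sort_hook:
  assumes B: "n < B" "st n < B" and pre: "hook_pre f x b p s"
    and K: "sorts V (arrs s 5) (arrs s 6) (regs s 7)"
  shows "wp B sort_hook (\<lambda>s'. frame s s' \<and>
    sorts (insert (x, b) V) (arrs s' 5) (arrs s' 6) (regs s' 7)) s"
proof -
  have b: "b \<in> N x" "x \<in> N b" "b < n" and x: "x < n"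
    using pre N_sym[of b x] N_bound[of b x] by (auto simp: hook_pre_def)
  have reg: "regs s 2 = x" "regs s 6 = pos b x" "arrs s 4 x = pos x x"
    using pre by (auto simp: hook_pre_def)
  have bounds: "pos b x < B" "pos x x < B" "x < B"
    using pos_le[OF b(3), of x] pos_le[OF x, of x] B x by auto
  have K': "sorts (insert (x, b) V) ((arrs s 5)(x := pos x x)) ((arrs s 6)(pos b x := x)) 0"
    unfolding sorts_def
  proof (intro conjI ballI)
    show "insert (x, b) V \<subseteq> arcs" using K b by (auto simp: sorts_def arcs_def)
    fix e assume e: "e \<in> insert (x, b) V"
    obtain y c where yc: "e = (y, c)" by (cases e)
    \<comment> \<open>The write to array 6 can hit an earlier entry only if it belongs to the same
      pair.\<close>
    have "(y = x \<and> c = b) \<or> pos c y \<noteq> pos b x" if "(y, c) \<in> V"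
    proof -
      have "y \<in> N c" using that K N_sym by (auto simp: sorts_def arcs_def)
      then show ?thesis using pos_eq[OF _ b(2), of y c] by blast
    qed
    then show "case e of (y, c) \<Rightarrow> ((arrs s 6)(pos b x := x)) (pos c y) = y \<and>
        ((arrs s 5)(x := pos x x)) y = pos y y"
      using e yc K by (auto simp: sorts_def)
  qed simp
  have "regs s 7 = 0" using K by (simp add: sorts_def)
  then show ?thesis
    using K' bounds by (simp add: sort_hook_def reg frame_def)
qed

section \<open>One pair of candidates for each oriented middle edge\<close>

context
  fixes ba ca bc bd cd :: bool
begin

text \<open>The four vertices are distinct because \<open>order_ok\<close> compares all six pairs of
  ranks strictly.\<close>

definition occurs :: "nat \<Rightarrow> nat \<Rightarrow> bool" where
  "occurs b c \<longleftrightarrow>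
     (\<exists>a\<in>N b. \<exists>d\<in>N c. order_ok ba ca bc bd cd (rk a) (rk b) (rk c) (rk d))"

text \<open>The end of the list of \<open>b\<close> if every neighbour fails the bound.\<close>

definition first_index :: "nat \<Rightarrow> nat \<Rightarrow> nat" where
  "first_index b c = st b + card {w \<in> N b. fails_lower (lower ba ca bc) (rk b) (rk c) (rk w)}"

text \<open>One past the last neighbour of \<open>c\<close> meeting the bound, and
  \<open>st c\<close> if there is none.\<close>

definition last_index :: "nat \<Rightarrow> nat \<Rightarrow> nat" where
  "last_index b c = st c + card {w \<in> N c. meets_upper (upper bc bd cd) (rk b) (rk c) (rk w)}"

lemma first_index_cand:
  assumes "first_index b c < st b + card (N b)"
  shows "\<exists>a\<in>N b. pos b a = first_index b c \<and> sorted_nbr (first_index b c) = a \<and>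
    \<not> fails_lower (lower ba ca bc) (rk b) (rk c) (rk a) \<and>
    (\<forall>u\<in>N b. \<not> fails_lower (lower ba ca bc) (rk b) (rk c) (rk u) \<longrightarrow> rk a \<le> rk u)"
proof -
  define R where "R = fails_lower (lower ba ca bc) (rk b) (rk c)"
  have "antimono R" unfolding R_def by (rule antimono_fails_lower)
  then obtain a where a: "a \<in> N b" "pos b a = first_index b c"
    "\<not> fails_lower (lower ba ca bc) (rk b) (rk c) (rk a)"
    "\<forall>u\<in>N b. \<not> fails_lower (lower ba ca bc) (rk b) (rk c) (rk u) \<longrightarrow> rk a \<le> rk u"
    using first_not[of R "first_index b c" b] assms
    by (auto simp: first_index_def R_def)
  then show ?thesis using sorted_nbr_pos[OF a(1)] by (intro bexI[of _ a]) auto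
qed

lemma last_index_cand:
  assumes "st c < last_index b c"
  shows "\<exists>d\<in>N c. pos c d = last_index b c - 1 \<and> sorted_nbr (last_index b c - 1) = d \<and>
    meets_upper (upper bc bd cd) (rk b) (rk c) (rk d) \<and>
    (\<forall>u\<in>N c. meets_upper (upper bc bd cd) (rk b) (rk c) (rk u) \<longrightarrow> rk u \<le> rk d)"
proof -
  define R where "R = meets_upper (upper bc bd cd) (rk b) (rk c)"
  have "antimono R" unfolding R_def by (rule antimono_meets_upper)
  then obtain d where d: "d \<in> N c" "pos c d = last_index b c - 1"
    "meets_upper (upper bc bd cd) (rk b) (rk c) (rk d)"
    "\<forall>u\<in>N c. meets_upper (upper bc bd cd) (rk b) (rk c) (rk u) \<longrightarrow> rk u \<le> rk d"
    using last_such[of R "last_index b c" c] assms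
    by (auto simp: last_index_def R_def)
  then show ?thesis using sorted_nbr_pos[OF d(1)] by (intro bexI[of _ d]) auto
qed

text \<open>Any occurrence shows that both candidates exist and can be exchanged for them;
  conversely, passing candidates form an occurrence themselves.\<close>

lemma occurs_iff:
  assumes "b \<in> N c"
  shows "occurs b c \<longleftrightarrow> first_index b c < st b + card (N b) \<and> st c < last_index b c \<and>
    order_ok ba ca bc bd cd (rk (sorted_nbr (first_index b c))) (rk b) (rk c)
      (rk (sorted_nbr (last_index b c - 1)))"
proof
  assume "occurs b c"
  then obtain a d where ad: "a \<in> N b" "d \<in> N c"
    and ok: "order_ok ba ca bc bd cd (rk a) (rk b) (rk c) (rk d)"
    by (auto simp: occurs_def)
  note bounds = order_ok_bounds[OF ok]
  have "{w \<in> N b. fails_lower (lower ba ca bc) (rk b) (rk c) (rk w)} \<subset> N b"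
    using ad bounds by blast
  from psubset_card_mono[OF finite_N this]
  have 1: "first_index b c < st b + card (N b)" by (simp add: first_index_def)
  have "{w \<in> N c. meets_upper (upper bc bd cd) (rk b) (rk c) (rk w)} \<noteq> {}"
    using ad bounds by blast
  then have 2: "st c < last_index b c" by (simp add: last_index_def card_gt_0_iff)
  obtain a' where a': "a' \<in> N b" "sorted_nbr (first_index b c) = a'"
    "\<not> fails_lower (lower ba ca bc) (rk b) (rk c) (rk a')" "rk a' \<le> rk a"
    using first_index_cand[OF 1] ad bounds by blast
  obtain d' where d': "d' \<in> N c" "sorted_nbr (last_index b c - 1) = d'"
    "meets_upper (upper bc bd cd) (rk b) (rk c) (rk d')" "rk d \<le> rk d'"
    using last_index_cand[OF 2] ad bounds by blast
  have "rk a' \<noteq> rk b" "rk d' \<noteq> rk c"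
    using N_bound[OF a'(1)] N_bound[OF d'(1)] rk_eq_iff by simp_all
  then show "first_index b c < st b + card (N b) \<and> st c < last_index b c \<and>
    order_ok ba ca bc bd cd (rk (sorted_nbr (first_index b c))) (rk b) (rk c)
      (rk (sorted_nbr (last_index b c - 1)))"
    using 1 2 order_ok_exchange[OF ok a'(3,4) _ d'(3,4)] a'(2) d'(2) by simp
next
  assume R: "first_index b c < st b + card (N b) \<and> st c < last_index b c \<and>
    order_ok ba ca bc bd cd (rk (sorted_nbr (first_index b c))) (rk b) (rk c)
      (rk (sorted_nbr (last_index b c - 1)))"
  then show "occurs b c"
    unfolding occurs_def
    using first_index_cand[of b c] last_index_cand[of c b] by blast
qed

text \<open>The second sweep only reads arrays 5 and 6, so their contents are described for all of
  \<open>arcs\<close> and only the answer depends on \<open>V\<close>.\<close>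

definition tested ::
  "(nat \<times> nat) set \<Rightarrow> (nat \<Rightarrow> nat) \<Rightarrow> (nat \<Rightarrow> nat) \<Rightarrow> nat \<Rightarrow> bool" where
  "tested V own S r \<longleftrightarrow> (\<forall>(x, b)\<in>arcs. S (pos b x) = x \<and> own x = pos x x) \<and>
     r = (if \<exists>(c, b)\<in>V. occurs b c then 1 else 0)"

lemma wp_load_first:
  assumes "b \<in> N c" "base s" "regs s 5 = b" "regs s 6 = pos b c" "arrs s 5 b = pos b b"
    and B: "n < B" "st n < B" and Q: "Q (set_reg 8 (first_index b c) s)"
  shows "wp B (load_first (lower ba ca bc)) Q s"
proof -
  have b: "b < n" "c \<in> N b" using N_bound[OF assms(1)] N_sym[OF assms(1)] by auto
  have st: "arrs s 0 b = st b" "st b < B"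
    using assms(2) b st_le[OF b(1)] B by (auto simp: base_def)
  have le: "pos b c < st n" "pos b b \<le> st n"
    using pos_less[OF b(2)] st_le[OF b(1)] pos_le[OF b(1)] by auto
  \<comment> \<open>For the bound \<open>At_c\<close> the vertex \<open>c\<close> itself is skipped,
    which is the added 1 in \<open>load_first\<close>.\<close>
  have "{w \<in> N b. rk w \<le> rk c} = insert c {w \<in> N b. rk w < rk c}"
  proof -
    have "rk w = rk c \<longleftrightarrow> w = c" if "w \<in> N b" for w
      using rk_eq_iff[of w c] N_bound[OF that] N_bound[OF b(2)] by simp
    then show ?thesis using b(2) by (auto simp: le_less)
  qed
  then have "card {w \<in> N b. rk w \<le> rk c} = Suc (card {w \<in> N b. rk w < rk c})" by simp
  then show ?thesis
    using Q st le B b assms(3-5)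
    by (cases "lower ba ca bc") (simp_all add: first_index_def pos_def)
qed

lemma wp_load_last:
  assumes "b \<in> N c" "base s" "regs s 2 = c" "regs s 3 = pos c b" "regs s 4 = st c + card (N c)"
    and "arrs s 5 c = pos c c"
    and B: "n < B" "st n < B" and Q: "Q (set_reg 9 (last_index b c) s)"
  shows "wp B (load_last (upper bc bd cd)) Q s"
proof -
  have c: "c < n" using N_bound[OF assms(1)] by auto
  have "st c + card (N c) < B" "pos c b < B" "pos c c < B"
    using st_le[OF c] pos_le[OF c, of b] pos_le[OF c, of c] B by auto
  then show ?thesis
    using Q B c assms(3-6)
    by (cases "upper bc bd cd") (simp_all add: last_index_def pos_def)
qed

lemma test_hook:
  assumes B: "n < B" "st n < B" and pre: "hook_pre sorted_nbr c b p s"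
    and K: "tested V (arrs s 5) (arrs s 6) (regs s 7)"
  shows "wp B (test_hook ba ca bc bd cd) (\<lambda>s'. frame s s' \<and>
    tested (insert (c, b) V) (arrs s' 5) (arrs s' 6) (regs s' 7)) s"
proof -
  define Q where "Q s' \<longleftrightarrow> frame s s' \<and>
    tested (insert (c, b) V) (arrs s' 5) (arrs s' 6) (regs s' 7)" for s'
  have H: "base s" "ranked s" "c < n" "b \<in> N c" "regs s 2 = c" "regs s 3 = p"
      "regs s 4 = st c + card (N c)" "regs s 5 = b" "regs s 6 = pos b c"
      "st c \<le> p" "p < st c + card (N c)" "sorted_nbr p = b"
    using pre by (auto simp: hook_pre_def)
  have b: "b < n" "c \<in> N b" using N_bound[OF H(4)] N_sym[OF H(4)] by auto
  obtain w where w: "w \<in> N c" "pos c w = p" using pos_ex[OF H(10,11)] .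
  \<comment> \<open>Entry \<open>p\<close> of the sorted list is \<open>b\<close>, so the loop index
    is the place of \<open>b\<close> in the list of \<open>c\<close>.\<close>
  then have p: "p = pos c b" using sorted_nbr_pos[OF w(1)] H(12) by simp
  have S: "arrs s 6 (pos v u) = u" "arrs s 5 v = pos v v" if "u \<in> N v" for u v
    using K N_sym[OF that] that by (auto simp: tested_def arcs_def)
  have rank: "arrs s 3 v = rk v" "rk v < B" if "v < n" for v
    using H(2) that rk[OF that] B by (auto simp: ranked_def)
  have start: "arrs s 0 v = st v" "arrs s 0 (Suc v) = st v + card (N v)"
    "st v < B" "st v + card (N v) < B" if "v < n" for v
    using H(1) that st_le[OF that] B by (auto simp: base_def st_Suc)
  have finish: "Q s'"
    if "frame s s'" "arrs s' 5 = arrs s 5" "arrs s' 6 = arrs s 6"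
      "regs s' 7 = (if occurs b c then 1 else regs s 7)" for s'
    using that K by (auto simp: Q_def tested_def)
  let ?tests = "[Less (Reg 8) (Reg 9), lt_test ba (Reg 10) (Reg 8), lt_test ca (Reg 11) (Reg 8),
    lt_test bc (Reg 10) (Reg 11), lt_test bd (Reg 10) (Reg 9), lt_test cd (Reg 11) (Reg 9)]"
  define compare where "compare = block [Sub 9 (Reg 9) (Const 1), Load 9 6 (Reg 9),
    Load 8 3 (Reg 8), Load 9 3 (Reg 9), Load 10 3 (Reg 5), Load 11 3 (Reg 2),
    guarded ?tests (Move 7 (Const 1))]"
  define check_d where "check_d = If (Less (Reg 10) (Reg 9)) compare Skip"
  define find_d where
    "find_d = Seq (load_last (upper bc bd cd)) (Seq (Load 10 0 (Reg 2)) check_d)"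
  define check_a where
    "check_a = If (Less (Reg 8) (Reg 9)) (Seq (Load 8 6 (Reg 8)) find_d) Skip"
  define find_a where "find_a = Seq (Add 9 (Reg 5) (Const 1)) (Seq (Load 9 0 (Reg 9)) check_a)"
  \<comment> \<open>\<open>u\<close>, \<open>v\<close> and \<open>w\<close> stand for intermediate
    values that have been overwritten or will be.\<close>
  have find_d: "wp B find_d Q (set_reg 8 a (set_reg 9 u (set_reg 9 v (set_reg 8 w s))))"
    (is "wp B _ _ ?s1")
    if fi: "first_index b c < st b + card (N b)" and a: "a \<in> N b" "sorted_nbr (first_index b c) = a"
    for a u v w
  proof -
    let ?s2 = "set_reg 10 (st c) (set_reg 9 (last_index b c) ?s1)"
    have a_n: "a < n" using N_bound[OF a(1)] by simp
    have "wp B check_d Q ?s2"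
    proof (cases "st c < last_index b c")
      case False
      then have "\<not> occurs b c" using occurs_iff[OF H(4)] by blast
      then have "Q ?s2" by (intro finish) (simp_all add: frame_def)
      then show ?thesis using False by (simp add: check_d_def)
    next
      case True
      then obtain d where d: "d \<in> N c" "pos c d = last_index b c - 1"
        "sorted_nbr (last_index b c - 1) = d"
        using last_index_cand by blast
      have d_n: "d < n" using N_bound[OF d(1)] by simp
      have read_d: "arrs s 6 (last_index b c - Suc 0) = d" "last_index b c - Suc 0 < B"
        using S(1)[OF d(1)] d(2) pos_le[OF H(3), of d] B by auto
      have occ: "occurs b c \<longleftrightarrow> order_ok ba ca bc bd cd (rk a) (rk b) (rk c) (rk d)"
        using occurs_iff[OF H(4)] fi True a(2) d(3) by simp
      let ?s3 = "set_reg 11 (rk c) (set_reg 10 (rk b) (set_reg 9 (rk d) (set_reg 8 (rk a)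
        (set_reg 9 d (set_reg 9 (last_index b c - Suc 0) ?s2)))))"
      have cond: "(\<forall>t\<in>set ?tests. holds ?s3 t) \<longleftrightarrow> occurs b c"
        unfolding occ order_ok_def by simp
      have "Q (if occurs b c then set_reg 7 1 ?s3 else ?s3)"
        by (intro finish) (simp_all add: frame_def)
      \<comment> \<open>The graph has a vertex, so the word bound admits the answer 1.\<close>
      moreover have "1 < B" using a_n B by simp
      ultimately have "wp B (guarded ?tests (Move 7 (Const 1))) Q ?s3"
        unfolding wp_guarded cond by (cases "occurs b c") simp_all
      then show ?thesis
        using True read_d rank[OF a_n] rank[OF d_n] rank[OF b(1)] rank[OF H(3)]
          a_n d_n b(1) H(3,5,8) B
        by (simp add: check_d_def compare_def del: guarded.simps)
    qed
    then have Q: "wp B (Seq (Load 10 0 (Reg 2)) check_d) Q (set_reg 9 (last_index b c) ?s1)"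
      using start[OF H(3)] H(3,5) B by simp
    have "wp B (load_last (upper bc bd cd)) (wp B (Seq (Load 10 0 (Reg 2)) check_d) Q) ?s1"
      by (rule wp_load_last[where b = b and c = c])
        (use H p S(2)[OF w(1)] B Q in \<open>simp_all add: base_def\<close>)
    then show ?thesis by (simp add: find_d_def)
  qed
  have "wp B find_a Q (set_reg 8 (first_index b c) s)"
  proof (cases "first_index b c < st b + card (N b)")
    case False
    then have "\<not> occurs b c" using occurs_iff[OF H(4)] by blast
    then have "Q (set_reg 9 (st b + card (N b)) (set_reg 9 (Suc b)
        (set_reg 8 (first_index b c) s)))"
      by (intro finish) (simp_all add: frame_def)
    then show ?thesis
      using False start[OF b(1)] b(1) H(8) B by (simp add: find_a_def check_a_def)
  next
    case True
    then obtain a where a: "a \<in> N b" "pos b a = first_index b c"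
      "sorted_nbr (first_index b c) = a"
      using first_index_cand by blast
    have "arrs s 6 (first_index b c) = a" "first_index b c < B" "a < B"
      using S(1)[OF a(1)] a(2) pos_le[OF b(1), of a] N_bound[OF a(1)] B by auto
    then show ?thesis
      using find_d[OF True a(1,3)] True start[OF b(1)] b(1) H(8) B
      by (simp add: find_a_def check_a_def)
  qed
  then have "wp B (load_first (lower ba ca bc)) (wp B find_a Q) s"
    by (rule wp_load_first[OF H(4,1,8,9) S(2)[OF b(2)] B])
  then show ?thesis
    unfolding Q_def[symmetric] test_hook_def find_a_def check_a_def find_d_def check_d_def
      compare_def
    by (simp only: block.simps wp.simps)
qed

lemma cost_test_hook: "cost (test_hook ba ca bc bd cd) \<le> 30"
proof -
  have "cost (load_first m) = 1" "cost (load_last m) = 1" for m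
    by (cases m; simp)+
  then show ?thesis by (simp add: test_hook_def)
qed

lemma detect:
  assumes B: "2 \<le> B" "n < B" "st n < B"
  shows "terminates B (detect ba ca bc bd cd) (input_state adj vs) (11 + 26 * n + 45 * st n)
    (\<lambda>s. regs s 0 = (if \<exists>(c, b)\<in>arcs. occurs b c then 1 else 0))"
proof -
  let ?s = "input_state adj vs"
  have "base ?s" "regs ?s 7 = 0"
    using vs n_def st_n by (auto simp: base_def input_state_def st_def)
  note rank = rank_loop[OF B(2) this(1)] and r7 = this(2)
  have sort: "terminates B (sweep 1 sort_hook) s (4 + 11 * n + (6 + cost sort_hook) * st n)
      (\<lambda>s'. base s' \<and> ranked s' \<and> sorts arcs (arrs s' 5) (arrs s' 6) (regs s' 7))"
    if "base s \<and> ranked s \<and> (\<forall>r. r \<notin> {1, 2} \<longrightarrow> regs s r = regs ?s r)" for s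
  proof (rule sweep[where K = sorts and f = "(!) (concat adj)", OF B(2,3)
      lists_neighbours_input _ sort_hook[OF B(2,3)]])
    fix s V x p
    assume "base s" "x < n" "p < st x + card (N x)"
    then show "arrs s 1 p = concat adj ! p"
      using st_le[of x] by (simp add: base_def)
  qed (use that r7 in \<open>auto simp: sorts_def\<close>)
  have test: "terminates B (sweep 6 (test_hook ba ca bc bd cd)) s
      (4 + 11 * n + (6 + cost (test_hook ba ca bc bd cd)) * st n)
      (\<lambda>s'. base s' \<and> ranked s' \<and> tested arcs (arrs s' 5) (arrs s' 6) (regs s' 7))"
    if "base s \<and> ranked s \<and> sorts arcs (arrs s 5) (arrs s 6) (regs s 7)" for s
  proof (rule sweep[where K = tested and f = sorted_nbr, OF B(2,3)
      lists_neighbours_sorted _ test_hook[OF B(2,3)]])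
    fix s V x p
    assume t: "tested V (arrs s 5) (arrs s 6) (regs s 7)" and "st x \<le> p" "p < st x + card (N x)"
    then obtain w where w: "w \<in> N x" "pos x w = p" using pos_ex by blast
    then have "(w, x) \<in> arcs" using N_sym by (simp add: arcs_def)
    then show "arrs s 6 p = sorted_nbr p"
      using t w sorted_nbr_pos[OF w(1)] by (auto simp: tested_def)
  qed (use that in \<open>auto simp: sorts_def tested_def\<close>)
  have answer: "terminates B (Move 0 (Reg 7)) s 1
      (\<lambda>s. regs s 0 = (if \<exists>(c, b)\<in>arcs. occurs b c then 1 else 0))"
    if "base s \<and> ranked s \<and> tested arcs (arrs s 5) (arrs s 6) (regs s 7)" for s
    using that B(1) by (intro terminates_wpI) (auto simp: tested_def)
  \<comment> \<open>An entry costs 6 + 3 steps while sorting and at most 6 + 30 while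
    testing.\<close>
  have time: "(6 + cost sort_hook) * st n + (6 + cost (test_hook ba ca bc bd cd)) * st n \<le> 45 * st n"
    unfolding add_mult_distrib[symmetric]
    using cost_test_hook by (intro mult_le_mono1) (simp add: sort_hook_def)
  show ?thesis
    unfolding detect_def
    by (rule terminates_mono[OF terminates_Seq[OF rank terminates_Seq[OF sort
      terminates_Seq[OF test answer]]]]) (assumption | use time in linarith)+
qed

end
end

section \<open>Occurrences of the pattern\<close>

lemma linear_order_on_iff:
  assumes "linear_order_on A r" "x \<in> A" "y \<in> A" "x \<noteq> y"
  shows "(x, y) \<in> r \<longleftrightarrow> (y, x) \<notin> r"
proof -
  have "total_on A r" "antisym r"
    using assms(1) by (auto simp: linear_order_on_def partial_order_on_def)
  then show ?thesis using assms(2-4) unfolding total_on_def antisym_def by blast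
qed

text \<open>With no forbidden pairs, an occurrence is a path in the graph whose six order relations
  agree with the pattern. Since \<open>arcs\<close> contains both orientations of each edge, each
  middle edge is tried in both roles.\<close>

lemma (in graph_input) contains_pattern_iff:
  assumes P: "is_pattern P" "positive P"
    and path: "distinct [a, b, c, d]" "pverts P = {a, b, c, d}"
      "mandatory P = {{a, b}, {b, c}, {c, d}}" "(a, d) \<in> pord P"
  defines "occ \<equiv> occurs ((b, a) \<in> pord P) ((c, a) \<in> pord P) ((b, c) \<in> pord P)
    ((b, d) \<in> pord P) ((c, d) \<in> pord P)"
  shows "contains_pattern G P \<longleftrightarrow> (\<exists>(y, x)\<in>arcs. occ x y)"
proof
  assume "contains_pattern G P"
  then obtain X f where X: "X \<subseteq> verts G" "bij_betw f X (pverts P)"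
    and ord: "\<forall>x\<in>X. \<forall>y\<in>X. (x, y) \<in> vord G \<longleftrightarrow> (f x, f y) \<in> pord P"
    and man: "\<forall>x\<in>X. \<forall>y\<in>X. {f x, f y} \<in> mandatory P \<longrightarrow> {x, y} \<in> edges G"
    unfolding contains_pattern_def by (elim exE conjE) (rule that; assumption)
  have "f ` X = {a, b, c, d}" using X(2) path(2) by (simp add: bij_betw_def)
  then have "a \<in> f ` X" "b \<in> f ` X" "c \<in> f ` X" "d \<in> f ` X" by auto
  then obtain a' b' c' d' where g: "a' \<in> X" "b' \<in> X" "c' \<in> X" "d' \<in> X"
    "f a' = a" "f b' = b" "f c' = c" "f d' = d" by (elim imageE) (rule that; simp)
  have "{a', b'} \<in> edges G" "{b', c'} \<in> edges G" "{c', d'} \<in> edges G"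
    using man[rule_format, OF g(1,2)] man[rule_format, OF g(2,3)] man[rule_format, OF g(3,4)]
    unfolding g(5-8) path(3) by simp_all
  then have N: "a' \<in> N b'" "b' \<in> N c'" "d' \<in> N c'"
    unfolding N_def by (simp_all add: insert_commute)
  have flag: "lt_flag ((f u, f v) \<in> pord P) (rk u) (rk v)"
    if "u \<in> X" "v \<in> X" "f u \<noteq> f v" for u v
  proof -
    have uv: "u < n" "v < n" using that(1,2) X(1) verts_eq by auto
    have "(f u, f v) \<in> pord P \<longleftrightarrow> rk u \<le> rk v"
      using ord[rule_format, OF that(1,2)] vord_iff[OF uv] by simp
    moreover have "rk u \<noteq> rk v" using rk_eq_iff[OF uv] that(3) by auto
    ultimately show ?thesis by (auto simp: lt_flag_def)
  qed
  have ne: "b \<noteq> a" "c \<noteq> a" "b \<noteq> c" "b \<noteq> d" "c \<noteq> d" "a \<noteq> d" using path(1) by auto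
  note flags = flag[OF g(1,4)] flag[OF g(2,1)] flag[OF g(3,1)] flag[OF g(2,3)] flag[OF g(2,4)]
    flag[OF g(3,4)]
  have "order_ok ((b, a) \<in> pord P) ((c, a) \<in> pord P) ((b, c) \<in> pord P) ((b, d) \<in> pord P)
      ((c, d) \<in> pord P) (rk a') (rk b') (rk c') (rk d')"
    using flags ne path(4) unfolding order_ok_def g(5-8) by (simp add: lt_flag_def)
  then have "occ b' c'" unfolding occ_def occurs_def using N by blast
  moreover have "(c', b') \<in> arcs" using N(2) by (simp add: arcs_def)
  ultimately show "\<exists>(y, x)\<in>arcs. occ x y" by blast
next
  assume "\<exists>(y, x)\<in>arcs. occ x y"
  then obtain c' b' where "(c', b') \<in> arcs" and occ: "occ b' c'" by blast
  then have "b' \<in> N c'" by (simp add: arcs_def)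
  moreover obtain a' d' where "a' \<in> N b'" "d' \<in> N c'"
    and ok: "order_ok ((b, a) \<in> pord P) ((c, a) \<in> pord P) ((b, c) \<in> pord P)
      ((b, d) \<in> pord P) ((c, d) \<in> pord P) (rk a') (rk b') (rk c') (rk d')"
    using occ unfolding occ_def occurs_def by blast
  ultimately have N: "b' \<in> N c'" "a' \<in> N b'" "d' \<in> N c'" by simp_all
  have bound: "a' < n" "b' < n" "c' < n" "d' < n"
    using N_bound[OF N(1)] N_bound[OF N(2)] N_bound[OF N(3)] by auto
  have lin: "linear_order_on (pverts P) (pord P)" using P(1) by (simp add: is_pattern_def)
  have refl_on: "refl_on (pverts P) (pord P)"
    using lin by (simp add: linear_order_on_def partial_order_on_def preorder_on_def)
  have refl: "(u, u) \<in> pord P" if "u \<in> {a, b, c, d}" for u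
    by (rule refl_onD[OF refl_on]) (use that path(2) in simp)
  have swap: "(v, u) \<in> pord P \<longleftrightarrow> (u, v) \<notin> pord P"
    if "u \<in> {a, b, c, d}" "v \<in> {a, b, c, d}" "u \<noteq> v" for u v
    by (rule linear_order_on_iff[OF lin]) (use that path(2) in simp_all)
  \<comment> \<open>The value \<open>d\<close> is the default; on the four chosen vertices only
    \<open>d'\<close> receives it.\<close>
  define f where "f x = (if x = a' then a else if x = b' then b else if x = c' then c else d)"
    for x
  \<comment> \<open>One flag fixes the order of a pair in both directions and makes the ranks
    different.\<close>
  have lt: "((u, v) \<in> pord P \<longleftrightarrow> x < y) \<and> ((v, u) \<in> pord P \<longleftrightarrow> y < x) \<and> x \<noteq> y"
    if "u \<in> {a, b, c, d}" "v \<in> {a, b, c, d}" "u \<noteq> v" "lt_flag ((u, v) \<in> pord P) x y" for u v x y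
    using that(4) swap[OF that(1-3)] by (cases "(u, v) \<in> pord P") (auto simp: lt_flag_def)
  have ad: "lt_flag ((a, d) \<in> pord P) (rk a') (rk d')"
    using ok path(4) by (simp add: order_ok_def lt_flag_def)
  have ok': "lt_flag ((b, a) \<in> pord P) (rk b') (rk a')" "lt_flag ((c, a) \<in> pord P) (rk c') (rk a')"
    "lt_flag ((b, c) \<in> pord P) (rk b') (rk c')" "lt_flag ((b, d) \<in> pord P) (rk b') (rk d')"
    "lt_flag ((c, d) \<in> pord P) (rk c') (rk d')"
    using ok by (simp_all add: order_ok_def)
  have ne: "a \<noteq> d" "b \<noteq> a" "c \<noteq> a" "b \<noteq> c" "b \<noteq> d" "c \<noteq> d" using path(1) by auto
  note orders = lt[OF _ _ ne(1) ad, simplified] lt[OF _ _ ne(2) ok'(1), simplified]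
    lt[OF _ _ ne(3) ok'(2), simplified] lt[OF _ _ ne(4) ok'(3), simplified]
    lt[OF _ _ ne(5) ok'(4), simplified] lt[OF _ _ ne(6) ok'(5), simplified]
  have ne': "a' \<noteq> d'" "b' \<noteq> a'" "c' \<noteq> a'" "b' \<noteq> c'" "b' \<noteq> d'" "c' \<noteq> d'"
    using orders by blast+
  have f: "f a' = a" "f b' = b" "f c' = c" "f d' = d"
    using ne' by (auto simp: f_def)
  let ?X = "{a', b', c', d'}"
  have bij: "bij_betw f ?X (pverts P)"
    using ne f path(2) by (auto simp: bij_betw_def inj_on_def)
  have ordered: "(x, y) \<in> vord G \<longleftrightarrow> (f x, f y) \<in> pord P" if "x \<in> ?X" "y \<in> ?X" for x y
  proof -
    have xy: "x < n" "y < n" using that bound by auto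
    have "(x, y) \<in> vord G \<longleftrightarrow> rk x \<le> rk y" by (rule vord_iff[OF xy])
    moreover have "rk x \<le> rk y \<longleftrightarrow> x = y \<or> rk x < rk y"
      using rk_eq_iff[OF xy] by (auto simp: le_less)
    ultimately show ?thesis
      using that by (auto simp: f refl orders ne')
  qed
  have edge: "{x, y} \<in> edges G"
    if "x \<in> ?X" "y \<in> ?X" "{f x, f y} \<in> mandatory P" for x y
  proof -
    have E: "{b', c'} \<in> edges G" "{a', b'} \<in> edges G" "{c', d'} \<in> edges G"
      using N(1) N_sym[OF N(2)] N(3) N_sym[OF N(1)] unfolding N_def by simp_all
    have E': "{c', b'} \<in> edges G" "{b', a'} \<in> edges G" "{d', c'} \<in> edges G"
      using E by (simp_all add: insert_commute)
    \<comment> \<open>Each pattern vertex has a single preimage, so a mandatory pair identifies its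
      two graph vertices.\<close>
    have inv: "(f u = a \<longleftrightarrow> u = a') \<and> (f u = b \<longleftrightarrow> u = b') \<and> (f u = c \<longleftrightarrow> u = c') \<and>
        (f u = d \<longleftrightarrow> u = d')" if "u \<in> ?X" for u
      using that by (elim insertE emptyE; simp add: f ne ne' ne[symmetric] ne'[symmetric])
    have "x = a' \<and> y = b' \<or> x = b' \<and> y = a' \<or> x = b' \<and> y = c' \<or> x = c' \<and> y = b' \<or>
        x = c' \<and> y = d' \<or> x = d' \<and> y = c'"
      using that(3) unfolding path(3) insert_iff empty_iff doubleton_eq_iff
      using inv[OF that(1)] inv[OF that(2)] by blast
    then show ?thesis
      using E E' by (elim disjE conjE) simp_all
  qed
  have "?X \<subseteq> verts G" using bound by (simp add: verts_eq)
  moreover have "forbidden P = {}" using P(2) by (simp add: positive_def)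
  ultimately show "contains_pattern G P"
    unfolding contains_pattern_def using bij bij_betw_same_card[OF bij] ordered edge
    by (intro exI[of _ ?X] exI[of _ f] conjI ballI impI) (assumption | simp)+
qed

lemma decidable_in_linear_time_path:
  assumes P: "is_pattern P" "positive P"
    and path: "distinct [a, b, c, d]" "pverts P = {a, b, c, d}"
      "mandatory P = {{a, b}, {b, c}, {c, d}}" "(a, d) \<in> pord P"
  shows "decidable_in_linear_time (\<lambda>G. contains_pattern G P)"
  unfolding decidable_in_linear_time_def Let_def
proof (rule exI[of _ "detect ((b, a) \<in> pord P) ((c, a) \<in> pord P) ((b, c) \<in> pord P)
      ((b, d) \<in> pord P) ((c, d) \<in> pord P)"], rule exI[of _ 100], intro allI impI)
  let ?p = "detect ((b, a) \<in> pord P) ((c, a) \<in> pord P) ((b, c) \<in> pord P)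
    ((b, d) \<in> pord P) ((c, d) \<in> pord P)"
  fix G adj vs
  assume G: "is_ordered_graph G" "represents adj vs G"
  interpret graph_input adj vs G by unfold_locales (fact G)+
  let ?B = "100 * (card (verts G) + card (edges G) + 1)"
  have n: "card (verts G) = n" by (simp add: verts_eq)
  \<comment> \<open>By \<open>st_n_le\<close> the time is at most 11 + 26n + 90m, so the factor 100
    serves both as time bound and as word bound.\<close>
  have B: "2 \<le> ?B" "n < ?B" "st n < ?B" "11 + 26 * n + 45 * st n \<le> ?B"
    using st_n_le by (simp_all add: n)
  have "terminates ?B ?p (input_state adj vs) (11 + 26 * n + 45 * st n)
      (\<lambda>s. regs s 0 = (if contains_pattern G P then 1 else 0))"
    unfolding contains_pattern_iff[OF P path] by (rule detect[OF B(1-3)])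
  then show "\<exists>t s. exec ?B ?p (input_state adj vs) t s \<and> t \<le> ?B \<and>
      regs s 0 = (if contains_pattern G P then 1 else 0)"
    unfolding terminates_def using B(4) order_trans by blast
qed

theorem theorem10:
  fixes P :: "'a pattern"
  assumes "is_pattern P"
    and "positive P"
    and "card (pverts P) = 4"
    and "mandatory_is_P4 P"
  shows "decidable_in_linear_time (\<lambda>G. contains_pattern G P)"
proof -
  obtain a b c d where path: "distinct [a, b, c, d]" "pverts P = {a, b, c, d}"
    "mandatory P = {{a, b}, {b, c}, {c, d}}"
    using assms(4) unfolding mandatory_is_P4_def by (elim exE conjE) (rule that)
  have lin: "linear_order_on (pverts P) (pord P)" using assms(1) by (simp add: is_pattern_def)
  show ?thesis
  proof (cases "(a, d) \<in> pord P")
    case True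
    then show ?thesis using decidable_in_linear_time_path[OF assms(1,2) path] by blast
  next
    case False
    \<comment> \<open>The reversed path has the same mandatory edges, and its first end precedes its
      last.\<close>
    have "distinct [d, c, b, a]" using path(1) by auto
    moreover have "pverts P = {d, c, b, a}" "mandatory P = {{d, c}, {c, b}, {b, a}}"
      unfolding path(2,3) by (simp_all add: insert_commute)
    moreover have "(d, a) \<in> pord P"
      using linear_order_on_iff[OF lin, of a d] False path(1,2) by simp
    ultimately show ?thesis by (rule decidable_in_linear_time_path[OF assms(1,2)])
  qed
qed

end
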